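(* Let $\mathbb{F}$ be a field of characteristic $0$, let $n=n_1+\dots+n_s$ with all $n_i\ge1$, and let $U(\mathscr{F})_0$ be the Lie algebra of trace-zero matrices in $UT(n_1,\ldots,n_s)\subset M_n(\mathbb{F})$. For any group $G$ (not assumed abelian), the support of any $G$-grading on $U(\mathscr{F})_0$ generates an abelian subgroup of $G$.
   Context: $UT(n_1,\ldots,n_s)$ is the algebra of $n\times n$ upper block-triangular matrices with diagonal blocks of sizes $n_1,\ldots,n_s$; its trace-zero matrices form a Lie algebra under $[x,y]=xy-yx$. A $G$-grading on a Lie algebra $L$ is a vector space decomposition $L=\bigoplus_{g\in G}L_g$ with $[L_g,L_h]\subset L_{gh}$ for all $g,h\in G$; its support is $\{g\in G\mid L_g\ne0\}$. *)

theory Defs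
  imports "Jordan_Normal_Form.VS_Connect" "HOL-Algebra.Generated_Groups"
begin

text \<open>A Lie algebra over \<open>K\<close> is a vector space record \<open>L\<close> whose multiplication field holds the
  bracket: \<open>x \<otimes>\<^bsub>L\<^esub> y\<close> is \<open>[x, y]\<close>. The \<open>one\<close> field of the record plays no role and need not lie in
  the carrier.\<close>

locale lie_algebra = vectorspace K L for K and L +
  assumes bracket_closed:
      "\<lbrakk>x \<in> carrier L; y \<in> carrier L\<rbrakk> \<Longrightarrow> x \<otimes>\<^bsub>L\<^esub> y \<in> carrier L"
    and bracket_add_left:
      "\<lbrakk>x \<in> carrier L; y \<in> carrier L; z \<in> carrier L\<rbrakk>
        \<Longrightarrow> (x \<oplus>\<^bsub>L\<^esub> y) \<otimes>\<^bsub>L\<^esub> z = x \<otimes>\<^bsub>L\<^esub> z \<oplus>\<^bsub>L\<^esub> y \<otimes>\<^bsub>L\<^esub> z"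
    and bracket_add_right:
      "\<lbrakk>x \<in> carrier L; y \<in> carrier L; z \<in> carrier L\<rbrakk>
        \<Longrightarrow> x \<otimes>\<^bsub>L\<^esub> (y \<oplus>\<^bsub>L\<^esub> z) = x \<otimes>\<^bsub>L\<^esub> y \<oplus>\<^bsub>L\<^esub> x \<otimes>\<^bsub>L\<^esub> z"
    and bracket_smult_left:
      "\<lbrakk>c \<in> carrier K; x \<in> carrier L; y \<in> carrier L\<rbrakk>
        \<Longrightarrow> (c \<odot>\<^bsub>L\<^esub> x) \<otimes>\<^bsub>L\<^esub> y = c \<odot>\<^bsub>L\<^esub> (x \<otimes>\<^bsub>L\<^esub> y)"
    and bracket_smult_right:
      "\<lbrakk>c \<in> carrier K; x \<in> carrier L; y \<in> carrier L\<rbrakk>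
        \<Longrightarrow> x \<otimes>\<^bsub>L\<^esub> (c \<odot>\<^bsub>L\<^esub> y) = c \<odot>\<^bsub>L\<^esub> (x \<otimes>\<^bsub>L\<^esub> y)"
    and bracket_self:
      "x \<in> carrier L \<Longrightarrow> x \<otimes>\<^bsub>L\<^esub> x = \<zero>\<^bsub>L\<^esub>"
    and jacobi:
      "\<lbrakk>x \<in> carrier L; y \<in> carrier L; z \<in> carrier L\<rbrakk>
        \<Longrightarrow> x \<otimes>\<^bsub>L\<^esub> (y \<otimes>\<^bsub>L\<^esub> z) \<oplus>\<^bsub>L\<^esub> y \<otimes>\<^bsub>L\<^esub> (z \<otimes>\<^bsub>L\<^esub> x) \<oplus>\<^bsub>L\<^esub> z \<otimes>\<^bsub>L\<^esub> (x \<otimes>\<^bsub>L\<^esub> y) = \<zero>\<^bsub>L\<^esub>"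

text \<open>The components \<open>\<Gamma> g\<close> matter only for \<open>g \<in> carrier G\<close>. As \<open>G\<close> may be infinite, and
  \<^const>\<open>finsum\<close> over an infinite set is zero by convention, the finiteness condition and the
  restriction of the sum to the nonzero terms are both needed.\<close>

locale lie_grading = lie_algebra K L + grp: group G for G and K and L +
  fixes \<Gamma>
  assumes component_subspace:
      "g \<in> carrier G \<Longrightarrow> subspace K (\<Gamma> g) L"
    and direct_sum:
      "x \<in> carrier L \<Longrightarrow>
        \<exists>!f. f \<in> (\<Pi>\<^sub>E g\<in>carrier G. \<Gamma> g) \<and>
             finite {g \<in> carrier G. f g \<noteq> \<zero>\<^bsub>L\<^esub>} \<and>
             x = (\<Oplus>\<^bsub>L\<^esub>g\<in>{g \<in> carrier G. f g \<noteq> \<zero>\<^bsub>L\<^esub>}. f g)"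
    and bracket_component:
      "\<lbrakk>g \<in> carrier G; h \<in> carrier G; x \<in> \<Gamma> g; y \<in> \<Gamma> h\<rbrakk> \<Longrightarrow> x \<otimes>\<^bsub>L\<^esub> y \<in> \<Gamma> (g \<otimes>\<^bsub>G\<^esub> h)"

definition grading_support ::
    "('g, 'm) monoid_scheme \<Rightarrow> ('v, 'r) ring_scheme \<Rightarrow> ('g \<Rightarrow> 'v set) \<Rightarrow> 'g set" where
  "grading_support G L \<Gamma> = {g \<in> carrier G. \<Gamma> g \<noteq> {\<zero>\<^bsub>L\<^esub>}}"

text \<open>Blocks are numbered from \<open>0\<close>, like matrix indices: block \<open>k\<close> has size \<open>ns ! k\<close>.\<close>

definition block :: "nat list \<Rightarrow> nat \<Rightarrow> nat set" where
  "block ns k = {sum_list (take k ns)..<sum_list (take (Suc k) ns)}"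

definition block_upper_triangular :: "nat list \<Rightarrow> 'a :: zero mat set" where
  "block_upper_triangular ns =
    {A \<in> carrier_mat (sum_list ns) (sum_list ns).
      \<forall>k < length ns. \<forall>l < k. \<forall>i \<in> block ns k. \<forall>j \<in> block ns l. A $$ (i, j) = 0}"

definition trace_mat :: "'a :: comm_monoid_add mat \<Rightarrow> 'a" where
  "trace_mat A = (\<Sum>i<dim_row A. A $$ (i, i))"

definition UT0 :: "nat list \<Rightarrow> ('a :: field, 'a mat) module" where
  "UT0 ns = (module_mat TYPE('a) (sum_list ns) (sum_list ns))
    \<lparr>carrier := {A \<in> block_upper_triangular ns. trace_mat A = 0},
     mult := \<lambda>x y. x * y - y * x\<rparr>"

lemma UT0_simps:
  "carrier (UT0 ns) = {A \<in> block_upper_triangular ns. trace_mat A = 0}"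
  "x \<otimes>\<^bsub>UT0 ns\<^esub> y = x * y - y * x"
  "x \<oplus>\<^bsub>UT0 ns\<^esub> y = x + y"
  "c \<odot>\<^bsub>UT0 ns\<^esub> x = c \<cdot>\<^sub>m x"
  "\<zero>\<^bsub>UT0 ns\<^esub> = 0\<^sub>m (sum_list ns) (sum_list ns)"
  by (simp_all add: UT0_def module_mat_simps)

lemma block_subset: "k < length ns \<Longrightarrow> block ns k \<subseteq> {..<sum_list ns}"
proof -
  have "sum_list (take (Suc k) ns) \<le> sum_list (take (Suc k) ns @ drop (Suc k) ns)"
    by (simp only: sum_list_append)
  then show ?thesis by (auto simp: block_def)
qed

lemma block_less: "\<lbrakk>k < length ns; i \<in> block ns k\<rbrakk> \<Longrightarrow> i < sum_list ns"
  using block_subset by fastforce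

lemma block_entry_less:
  assumes "k < length ns" "l < k" "i \<in> block ns k" "j \<in> block ns l"
  shows "i < sum_list ns" "j < sum_list ns"
  using assms block_less[of k ns i] block_less[of l ns j] by auto

lemma ex_block: "i < sum_list ns \<Longrightarrow> \<exists>k < length ns. i \<in> block ns k"
proof (induction ns rule: rev_induct)
  case (snoc m ns)
  show ?case
  proof (cases "i < sum_list ns")
    case True
    then obtain k where "k < length ns" "i \<in> block ns k" using snoc by blast
    then show ?thesis by (intro exI[of _ k]) (auto simp: block_def)
  next
    case False
    with snoc show ?thesis by (intro exI[of _ "length ns"]) (auto simp: block_def)
  qed
qed simp

lemma block_upper_triangular_mult:
  fixes A B :: "'a :: field mat"
  assumes A: "A \<in> block_upper_triangular ns" and B: "B \<in> block_upper_triangular ns"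
  shows "A * B \<in> block_upper_triangular ns"
proof -
  let ?n = "sum_list ns"
  have cA: "A \<in> carrier_mat ?n ?n" and cB: "B \<in> carrier_mat ?n ?n"
    using A B by (auto simp: block_upper_triangular_def)
  have "(A * B) $$ (i, j) = 0"
    if k: "k < length ns" and l: "l < k" and i: "i \<in> block ns k" and j: "j \<in> block ns l" for k l i j
  proof -
    have ij: "i < ?n" "j < ?n" using block_subset[OF k] block_subset[of l ns] k l i j by auto
    have "A $$ (i, t) * B $$ (t, j) = 0" if "t < ?n" for t
    proof -
      obtain m where m: "m < length ns" "t \<in> block ns m" using ex_block[OF \<open>t < ?n\<close>] by blast
      show ?thesis
      proof (cases "m < k")
        case True
        then show ?thesis using A k i m by (auto simp: block_upper_triangular_def)
      next
        case False
        then have "l < m" using l by simp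
        then show ?thesis using B j m by (auto simp: block_upper_triangular_def)
      qed
    qed
    then show ?thesis using cA cB ij by (auto simp: scalar_prod_def intro!: sum.neutral)
  qed
  then show ?thesis using cA cB by (auto simp: block_upper_triangular_def)
qed

lemma trace_mat_mult_comm:
  fixes A B :: "'a :: field mat"
  assumes "A \<in> carrier_mat n n" "B \<in> carrier_mat n n"
  shows "trace_mat (A * B) = trace_mat (B * A)"
proof -
  have "trace_mat (A * B) = (\<Sum>i<n. \<Sum>j<n. A $$ (i, j) * B $$ (j, i))"
    using assms by (auto simp: trace_mat_def scalar_prod_def lessThan_atLeast0 intro!: sum.cong)
  also have "\<dots> = (\<Sum>j<n. \<Sum>i<n. B $$ (j, i) * A $$ (i, j))"
    by (subst sum.swap) (simp add: mult.commute)
  also have "\<dots> = trace_mat (B * A)"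
    using assms by (auto simp: trace_mat_def scalar_prod_def lessThan_atLeast0 intro!: sum.cong)
  finally show ?thesis .
qed

lemma UT0_subspace:
  "subspace (class_ring :: 'a :: field ring) (carrier (UT0 ns :: ('a, 'a mat) module))
    (module_mat TYPE('a) (sum_list ns) (sum_list ns))"
proof -
  let ?n = "sum_list ns"
  show ?thesis
    unfolding subspace_def submodule_def UT0_simps
    using matrix_vs[where ?'a = 'a]
    by (auto simp: vectorspace_def module_mat_simps block_upper_triangular_def trace_mat_def
        sum.distrib block_entry_less simp flip: sum_distrib_left)
qed

lemma vectorspace_mult_update:
  assumes "vectorspace K V"
  shows "vectorspace K (V\<lparr>mult := b\<rparr>)"
  using assms
  by (simp add: vectorspace_def Module.module_def Module.module_axioms_def abelian_group_def
      abelian_monoid_def abelian_group_axioms_def)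

lemma commutator_jacobi:
  fixes x y z :: "'a :: field mat"
  assumes "x \<in> carrier_mat n n" "y \<in> carrier_mat n n" "z \<in> carrier_mat n n"
  shows "(x * (y * z - z * y) - (y * z - z * y) * x) + (y * (z * x - x * z) - (z * x - x * z) * y)
    + (z * (x * y - y * x) - (x * y - y * x) * z) = 0\<^sub>m n n"
proof -
  have expand: "a * (b * c - c * b) - (b * c - c * b) * a
      = a * (b * c) + - (a * (c * b)) + - (b * (c * a)) + c * (b * a)"
    if "a \<in> carrier_mat n n" "b \<in> carrier_mat n n" "c \<in> carrier_mat n n" for a b c :: "'a mat"
  proof -
    have "a * (b * c - c * b) = a * (b * c) - a * (c * b)"
      using that by (intro mult_minus_distrib_mat[of _ n n _ n]) auto
    moreover have "(b * c - c * b) * a = b * (c * a) - c * (b * a)"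
      using that by (subst minus_mult_distrib_mat[of _ n n _ _ n])
        (auto simp: assoc_mult_mat[of _ n n _ n _ n])
    ultimately show ?thesis
      using that by (intro eq_matI) (auto simp: algebra_simps)
  qed
  show ?thesis
    unfolding expand[OF assms] expand[OF assms(2,3,1)] expand[OF assms(3,1,2)]
    using assms by (intro eq_matI) (auto simp del: index_mult_mat(1))
qed

lemma lie_algebra_UT0: "lie_algebra (class_ring :: 'a :: field ring) (UT0 ns)"
proof -
  let ?n = "sum_list ns" and ?L = "UT0 ns :: ('a, 'a mat) module"
  let ?M = "module_mat TYPE('a) ?n ?n"
  have car: "x \<in> carrier_mat ?n ?n" if "x \<in> carrier ?L" for x
    using that by (auto simp: UT0_simps block_upper_triangular_def)
  interpret M: vectorspace class_ring ?M by (rule matrix_vs)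
  have "vectorspace class_ring (?M\<lparr>carrier := carrier ?L\<rparr>)"
    by (rule M.subspace_is_vs[OF UT0_subspace])
  then have vs: "vectorspace class_ring ?L"
    using vectorspace_mult_update[of class_ring "?M\<lparr>carrier := carrier ?L\<rparr>" "\<lambda>x y. x * y - y * x"]
    by (simp add: UT0_def)
  have closed: "x * y - y * x \<in> carrier ?L" if "x \<in> carrier ?L" "y \<in> carrier ?L" for x y
  proof -
    have xy: "x * y \<in> block_upper_triangular ns" "y * x \<in> block_upper_triangular ns"
      using that block_upper_triangular_mult by (auto simp: UT0_simps)
    have "x * y - y * x \<in> block_upper_triangular ns"
      using xy car[OF that(1)] car[OF that(2)] unfolding block_upper_triangular_def
      by (auto simp: block_entry_less simp del: index_mult_mat(1))
    moreover have "trace_mat (x * y - y * x) = trace_mat (x * y) - trace_mat (y * x)"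
      using car[OF that(1)] car[OF that(2)]
      by (auto simp: trace_mat_def sum_subtractf[symmetric] intro!: sum.cong
          simp del: index_mult_mat(1))
    ultimately show ?thesis
      using trace_mat_mult_comm[OF car[OF that(1)] car[OF that(2)]] by (simp add: UT0_simps)
  qed
  have "lie_algebra_axioms (class_ring :: 'a ring) ?L"
  proof
    fix x y z :: "'a mat" and c :: 'a
    assume x: "x \<in> carrier ?L" and y: "y \<in> carrier ?L"
    note xy = car[OF x] car[OF y]
    show "x \<otimes>\<^bsub>?L\<^esub> y \<in> carrier ?L"
      using closed[OF x y] by (simp add: UT0_simps(2))
    show "(c \<odot>\<^bsub>?L\<^esub> x) \<otimes>\<^bsub>?L\<^esub> y = c \<odot>\<^bsub>?L\<^esub> (x \<otimes>\<^bsub>?L\<^esub> y)"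
      "x \<otimes>\<^bsub>?L\<^esub> (c \<odot>\<^bsub>?L\<^esub> y) = c \<odot>\<^bsub>?L\<^esub> (x \<otimes>\<^bsub>?L\<^esub> y)"
      using xy unfolding UT0_simps
      by (auto intro!: eq_matI simp: right_diff_distrib)
    show "x \<otimes>\<^bsub>?L\<^esub> x = \<zero>\<^bsub>?L\<^esub>"
      using xy by (auto simp: UT0_simps)
    assume z: "z \<in> carrier ?L"
    note xyz = xy car[OF z]
    show "(x \<oplus>\<^bsub>?L\<^esub> y) \<otimes>\<^bsub>?L\<^esub> z = x \<otimes>\<^bsub>?L\<^esub> z \<oplus>\<^bsub>?L\<^esub> y \<otimes>\<^bsub>?L\<^esub> z"
      "x \<otimes>\<^bsub>?L\<^esub> (y \<oplus>\<^bsub>?L\<^esub> z) = x \<otimes>\<^bsub>?L\<^esub> y \<oplus>\<^bsub>?L\<^esub> x \<otimes>\<^bsub>?L\<^esub> z"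
      using xyz unfolding UT0_simps
      by (auto intro!: eq_matI simp: add_mult_distrib_mat[of _ ?n ?n _ _ ?n]
          mult_add_distrib_mat[of _ ?n ?n _ ?n] simp del: index_mult_mat(1))
    show "x \<otimes>\<^bsub>?L\<^esub> (y \<otimes>\<^bsub>?L\<^esub> z) \<oplus>\<^bsub>?L\<^esub> y \<otimes>\<^bsub>?L\<^esub> (z \<otimes>\<^bsub>?L\<^esub> x) \<oplus>\<^bsub>?L\<^esub> z \<otimes>\<^bsub>?L\<^esub> (x \<otimes>\<^bsub>?L\<^esub> y) = \<zero>\<^bsub>?L\<^esub>"
      using commutator_jacobi[OF xyz] by (simp add: UT0_simps)
  qed
  with vs show ?thesis by (rule lie_algebra.intro)
qed

end

theory Submission
  imports Defs
begin

text \<open>The idea is to find, in a Lie algebra \<open>L\<close>, a subspace \<open>N\<close> so small that it does not matter for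
  generating \<open>L\<close> and so large that every ideal outside \<open>N\<close> almost contains its own annihilator.
  Precisely, suppose that

  \<^item> a subalgebra \<open>S\<close> with \<open>S + N = L\<close> is all of \<open>L\<close>, and
  \<^item> for each ideal \<open>I\<close> not inside \<open>N\<close>, the annihilator \<open>{c. [c, I] = 0}\<close> lies in \<open>I + N\<close>.

  Then the support of any grading of \<open>L\<close> by any group commutes (\<open>support_commutes\<close>). Let \<open>L\<^sub>a\<close> be a
  component not inside \<open>N\<close>, \<open>I\<close> the ideal that it generates, and \<open>H\<close> the centralizer of \<open>a\<close> in the
  group. Antisymmetry and the Jacobi identity show that a homogeneous element that does not annihilate
  \<open>I\<close> has its degree in \<open>H\<close> (\<open>degree_commutes\<close>); hence \<open>I\<close> itself lives in degrees from \<open>H\<close>. So each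
  homogeneous element either has degree in \<open>H\<close>, or annihilates \<open>I\<close> and thus lies in \<open>I + N\<close>. The
  subalgebra of the degrees in \<open>H\<close> therefore equals \<open>L\<close> modulo \<open>N\<close>, so it is \<open>L\<close>, and \<open>a\<close> commutes
  with the whole support. Finally the degrees that commute with the whole support form a subgroup, whose
  subalgebra again equals \<open>L\<close> modulo \<open>N\<close>, because the other components lie inside \<open>N\<close>.

  For the trace-zero block-triangular matrices, let \<open>N\<close> consist of the matrices that vanish on the block
  diagonal and on the first block superdiagonal. If \<open>J\<close> denotes the strictly block-triangular matrices,
  then \<open>N = [J, J]\<close>, and the first condition is the familiar fact that a nilpotent Lie algebra is
  generated by any set that spans it modulo its commutator (\<open>subalgebra_eq_UT0\<close>). For the second
  (\<open>annihilator_of_ideal\<close>), the roots of the diagonal torus are nonzero and distinct in characteristic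
  \<open>0\<close>, so an ideal contains an elementary matrix wherever one of its elements has a nonzero off-diagonal
  entry. An ideal not inside \<open>N\<close> thus contains some \<open>E\<^sub>p\<^sub>q\<close> with the block of \<open>q\<close> at most one step after
  that of \<open>p\<close>, and all off-diagonal elementary matrices whose row lies in the block of \<open>p\<close> or
  before it and whose column lies in the block of \<open>q\<close> or after it; comparing entries in \<open>[c, E] = 0\<close>
  for these leaves no room for an annihilating \<open>c\<close> outside \<open>I + N\<close>.\<close>

section \<open>Abelian subgroups generated by commuting elements\<close>

definition centralizer :: "('g, 'm) monoid_scheme \<Rightarrow> 'g set \<Rightarrow> 'g set" where
  "centralizer G S = {g \<in> carrier G. \<forall>s \<in> S. g \<otimes>\<^bsub>G\<^esub> s = s \<otimes>\<^bsub>G\<^esub> g}"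

lemma (in group) centralizer_subgroup:
  assumes S: "S \<subseteq> carrier G"
  shows "subgroup (centralizer G S) G"
proof (rule subgroupI)
  show "centralizer G S \<noteq> {}"
    using S by (auto simp: centralizer_def intro!: exI[of _ \<one>])
next
  fix a assume a: "a \<in> centralizer G S"
  have "inv a \<otimes> s = s \<otimes> inv a" if s: "s \<in> S" for s
  proof -
    have "a \<in> carrier G" "s \<in> carrier G" "a \<otimes> s = s \<otimes> a"
      using a s S by (auto simp: centralizer_def)
    then show ?thesis
      by (metis inv_closed inv_solve_left' inv_solve_right' m_assoc m_closed)
  qed
  with a show "inv a \<in> centralizer G S" by (auto simp: centralizer_def)
next
  fix a b assume ab: "a \<in> centralizer G S" "b \<in> centralizer G S"
  have "a \<otimes> b \<otimes> s = s \<otimes> (a \<otimes> b)" if s: "s \<in> S" for s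
  proof -
    have "a \<in> carrier G" "b \<in> carrier G" "s \<in> carrier G" "a \<otimes> s = s \<otimes> a" "b \<otimes> s = s \<otimes> b"
      using ab s S by (auto simp: centralizer_def)
    then show ?thesis by (metis m_assoc)
  qed
  with ab show "a \<otimes> b \<in> centralizer G S" by (auto simp: centralizer_def)
qed (auto simp: centralizer_def)

text \<open>Two passages to the double centralizer: \<open>S\<close> centralizes \<open>S\<close>, so the generated subgroup does; then
  \<open>S\<close> centralizes the generated subgroup, so the generated subgroup centralizes itself.\<close>

lemma (in group) generate_comm_group:
  assumes S: "S \<subseteq> carrier G" and comm: "\<And>a b. a \<in> S \<Longrightarrow> b \<in> S \<Longrightarrow> a \<otimes> b = b \<otimes> a"
  shows "comm_group (G\<lparr>carrier := generate G S\<rparr>)"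
proof -
  let ?A = "generate G S"
  have A: "?A \<subseteq> carrier G" using generate_incl[OF S] .
  have "?A \<subseteq> centralizer G S"
    using S comm by (intro generate_subgroup_incl centralizer_subgroup) (auto simp: centralizer_def)
  then have "S \<subseteq> centralizer G ?A"
    using S by (fastforce simp: centralizer_def)
  then have "?A \<subseteq> centralizer G ?A"
    by (rule generate_subgroup_incl[OF _ centralizer_subgroup[OF A]])
  moreover have "group (G\<lparr>carrier := ?A\<rparr>)"
    using generate_is_subgroup[OF S] by (rule subgroup_imp_group)
  ultimately show ?thesis
    by (intro group.group_comm_groupI) (auto simp: centralizer_def)
qed

section \<open>Graded parts of a graded Lie algebra\<close>

definition lie_subalgebra ::
    "('k, 'n) ring_scheme \<Rightarrow> ('k, 'v, 'm) module_scheme \<Rightarrow> 'v set \<Rightarrow> bool" where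
  "lie_subalgebra K L S \<longleftrightarrow> subspace K S L \<and> (\<forall>x \<in> S. \<forall>y \<in> S. x \<otimes>\<^bsub>L\<^esub> y \<in> S)"

definition lie_ideal ::
    "('k, 'n) ring_scheme \<Rightarrow> ('k, 'v, 'm) module_scheme \<Rightarrow> 'v set \<Rightarrow> bool" where
  "lie_ideal K L I \<longleftrightarrow> subspace K I L \<and> (\<forall>x \<in> carrier L. \<forall>y \<in> I. x \<otimes>\<^bsub>L\<^esub> y \<in> I)"

context lie_algebra
begin

lemma bracket_zero_right:
  assumes x: "x \<in> carrier L" shows "x \<otimes>\<^bsub>L\<^esub> \<zero>\<^bsub>L\<^esub> = \<zero>\<^bsub>L\<^esub>"
proof -
  have "x \<otimes>\<^bsub>L\<^esub> \<zero>\<^bsub>L\<^esub> \<oplus>\<^bsub>L\<^esub> x \<otimes>\<^bsub>L\<^esub> \<zero>\<^bsub>L\<^esub> = x \<otimes>\<^bsub>L\<^esub> \<zero>\<^bsub>L\<^esub> \<oplus>\<^bsub>L\<^esub> \<zero>\<^bsub>L\<^esub>"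
    using x bracket_add_right[of x "\<zero>\<^bsub>L\<^esub>" "\<zero>\<^bsub>L\<^esub>"] bracket_closed[of x "\<zero>\<^bsub>L\<^esub>"] by simp
  then show ?thesis using bracket_closed[OF x, of "\<zero>\<^bsub>L\<^esub>"] by simp
qed

lemma bracket_antisym:
  assumes x: "x \<in> carrier L" and y: "y \<in> carrier L"
  shows "x \<otimes>\<^bsub>L\<^esub> y = \<ominus>\<^bsub>L\<^esub> (y \<otimes>\<^bsub>L\<^esub> x)"
proof -
  have "\<zero>\<^bsub>L\<^esub> = (x \<oplus>\<^bsub>L\<^esub> y) \<otimes>\<^bsub>L\<^esub> (x \<oplus>\<^bsub>L\<^esub> y)"
    using x y by (simp add: bracket_self)
  also have "\<dots> = x \<otimes>\<^bsub>L\<^esub> y \<oplus>\<^bsub>L\<^esub> y \<otimes>\<^bsub>L\<^esub> x"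
  proof -
    have "(x \<oplus>\<^bsub>L\<^esub> y) \<otimes>\<^bsub>L\<^esub> (x \<oplus>\<^bsub>L\<^esub> y)
        = (x \<otimes>\<^bsub>L\<^esub> x \<oplus>\<^bsub>L\<^esub> x \<otimes>\<^bsub>L\<^esub> y) \<oplus>\<^bsub>L\<^esub> (y \<otimes>\<^bsub>L\<^esub> x \<oplus>\<^bsub>L\<^esub> y \<otimes>\<^bsub>L\<^esub> y)"
      unfolding bracket_add_left[OF x y M.a_closed[OF x y]]
        bracket_add_right[OF x x y] bracket_add_right[OF y x y] ..
    then show ?thesis using x y bracket_closed by (simp only: bracket_self[OF x] bracket_self[OF y]) simp
  qed
  finally show ?thesis using x y bracket_closed by (metis M.minus_equality)
qed

lemma bracket_zero_left:
  assumes "x \<in> carrier L" shows "\<zero>\<^bsub>L\<^esub> \<otimes>\<^bsub>L\<^esub> x = \<zero>\<^bsub>L\<^esub>"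
  using assms bracket_antisym[of "\<zero>\<^bsub>L\<^esub>" x] bracket_zero_right by simp

text \<open>The form in which the Jacobi identity is used: if \<open>x\<close> acts nontrivially on \<open>[y, z]\<close>, then \<open>x\<close> or
  \<open>[x, y]\<close> already acts nontrivially on \<open>z\<close>.\<close>

lemma bracket_bracket_eq_zero:
  assumes x: "x \<in> carrier L" and y: "y \<in> carrier L" and z: "z \<in> carrier L"
    and zx: "x \<otimes>\<^bsub>L\<^esub> z = \<zero>\<^bsub>L\<^esub>" and xy: "(x \<otimes>\<^bsub>L\<^esub> y) \<otimes>\<^bsub>L\<^esub> z = \<zero>\<^bsub>L\<^esub>"
  shows "x \<otimes>\<^bsub>L\<^esub> (y \<otimes>\<^bsub>L\<^esub> z) = \<zero>\<^bsub>L\<^esub>"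
proof -
  have "z \<otimes>\<^bsub>L\<^esub> x = \<zero>\<^bsub>L\<^esub>" using bracket_antisym[OF z x] zx by simp
  moreover have "z \<otimes>\<^bsub>L\<^esub> (x \<otimes>\<^bsub>L\<^esub> y) = \<zero>\<^bsub>L\<^esub>"
    using bracket_antisym[OF z bracket_closed[OF x y]] xy by simp
  ultimately show ?thesis
    using jacobi[OF x y z] bracket_closed[OF x bracket_closed[OF y z]] bracket_zero_right[OF y]
    by simp
qed

end

context lie_grading
begin

lemma component_closed: "g \<in> carrier G \<Longrightarrow> x \<in> \<Gamma> g \<Longrightarrow> x \<in> carrier L"
  using component_subspace[of g] by (auto simp: subspace_def submodule_def)

lemma zero_in_component: "g \<in> carrier G \<Longrightarrow> \<zero>\<^bsub>L\<^esub> \<in> \<Gamma> g"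
  using component_subspace[of g] by (auto simp: subspace_def submodule_def)

lemma component_add_closed:
  "g \<in> carrier G \<Longrightarrow> x \<in> \<Gamma> g \<Longrightarrow> y \<in> \<Gamma> g \<Longrightarrow> x \<oplus>\<^bsub>L\<^esub> y \<in> \<Gamma> g"
  using component_subspace[of g] by (auto simp: subspace_def submodule_def)

lemma component_smult_closed:
  "g \<in> carrier G \<Longrightarrow> c \<in> carrier K \<Longrightarrow> x \<in> \<Gamma> g \<Longrightarrow> c \<odot>\<^bsub>L\<^esub> x \<in> \<Gamma> g"
  using component_subspace[of g] by (auto simp: subspace_def submodule_def)

text \<open>The sum of the components with degree in \<open>H\<close>. Building it from homogeneous elements by addition
  makes induction over homogeneous elements available, also on the whole algebra
  (\<open>carrier_eq_graded_part\<close>).\<close>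

inductive_set graded_part for H where
  zero: "\<zero>\<^bsub>L\<^esub> \<in> graded_part H"
| hom: "h \<in> H \<Longrightarrow> x \<in> \<Gamma> h \<Longrightarrow> x \<in> graded_part H"
| add: "x \<in> graded_part H \<Longrightarrow> y \<in> graded_part H \<Longrightarrow> x \<oplus>\<^bsub>L\<^esub> y \<in> graded_part H"

lemma graded_part_closed:
  assumes "x \<in> graded_part H" "H \<subseteq> carrier G" shows "x \<in> carrier L"
  using assms by induction (auto simp: component_closed)

definition decomposes where
  "decomposes f x \<longleftrightarrow> f \<in> (\<Pi>\<^sub>E g\<in>carrier G. \<Gamma> g) \<and> finite {g \<in> carrier G. f g \<noteq> \<zero>\<^bsub>L\<^esub>} \<and>
    x = (\<Oplus>\<^bsub>L\<^esub>g\<in>{g \<in> carrier G. f g \<noteq> \<zero>\<^bsub>L\<^esub>}. f g)"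

lemma decomposes_unique:
  assumes "x \<in> carrier L" "decomposes f x" "decomposes f' x" shows "f = f'"
  using direct_sum[OF assms(1)] assms(2,3) unfolding decomposes_def by blast

text \<open>The sum may run over any finite set of degrees outside of which \<open>f\<close> vanishes. This allows adding
  two decompositions with different sets of nonzero terms.\<close>

lemma decomposesI:
  assumes f: "f \<in> (\<Pi>\<^sub>E g\<in>carrier G. \<Gamma> g)" and A: "finite A" "A \<subseteq> carrier G"
    and out: "\<And>g. g \<in> carrier G - A \<Longrightarrow> f g = \<zero>\<^bsub>L\<^esub>" and x: "x = (\<Oplus>\<^bsub>L\<^esub>g\<in>A. f g)"
  shows "decomposes f x"
proof -
  have sub: "{g \<in> carrier G. f g \<noteq> \<zero>\<^bsub>L\<^esub>} \<subseteq> A" using out by blast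
  have "(\<Oplus>\<^bsub>L\<^esub>g\<in>A. f g) = (\<Oplus>\<^bsub>L\<^esub>g\<in>{g \<in> carrier G. f g \<noteq> \<zero>\<^bsub>L\<^esub>}. f g)"
    using f A sub by (intro M.add.finprod_mono_neutral_cong_right) (auto intro: component_closed)
  then show ?thesis
    using f x finite_subset[OF sub A(1)] by (simp add: decomposes_def)
qed

lemma graded_part_decomposition:
  assumes "x \<in> graded_part H" "H \<subseteq> carrier G"
  shows "\<exists>f. decomposes f x \<and> (\<forall>g \<in> carrier G - H. f g = \<zero>\<^bsub>L\<^esub>)"
  using assms
proof induction
  case zero
  have "decomposes (\<lambda>g\<in>carrier G. \<zero>\<^bsub>L\<^esub>) \<zero>\<^bsub>L\<^esub>"
    by (rule decomposesI[of _ "{}"]) (auto simp: zero_in_component)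
  then show ?case by (intro exI conjI ballI) (assumption, simp)
next
  case (hom h x)
  let ?f = "\<lambda>g\<in>carrier G. if g = h then x else \<zero>\<^bsub>L\<^esub>"
  have "decomposes ?f x"
    using hom by (intro decomposesI[of _ "{h}"]) (auto simp: zero_in_component component_closed)
  then show ?case using hom by (intro exI[of _ ?f] conjI ballI) (assumption, auto)
next
  case (add x y)
  then obtain f f' where f: "decomposes f x" "\<forall>g \<in> carrier G - H. f g = \<zero>\<^bsub>L\<^esub>"
    and f': "decomposes f' y" "\<forall>g \<in> carrier G - H. f' g = \<zero>\<^bsub>L\<^esub>" by blast
  let ?s = "\<lambda>g\<in>carrier G. f g \<oplus>\<^bsub>L\<^esub> f' g"
  let ?A = "{g \<in> carrier G. f g \<noteq> \<zero>\<^bsub>L\<^esub>} \<union> {g \<in> carrier G. f' g \<noteq> \<zero>\<^bsub>L\<^esub>}"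
  have fin: "finite ?A" using f f' by (auto simp: decomposes_def)
  have mem: "f g \<in> \<Gamma> g" "f' g \<in> \<Gamma> g" if "g \<in> carrier G" for g
    using f f' that by (auto simp: decomposes_def)
  have car: "f g \<in> carrier L" "f' g \<in> carrier L" if "g \<in> carrier G" for g
    using mem[OF that] that component_closed by auto
  have x: "x = (\<Oplus>\<^bsub>L\<^esub>g\<in>?A. f g)"
    using f(1) fin car unfolding decomposes_def
    by (auto intro!: M.add.finprod_mono_neutral_cong_left)
  have y: "y = (\<Oplus>\<^bsub>L\<^esub>g\<in>?A. f' g)"
    using f'(1) fin car unfolding decomposes_def
    by (auto intro!: M.add.finprod_mono_neutral_cong_left)
  have "x \<oplus>\<^bsub>L\<^esub> y = (\<Oplus>\<^bsub>L\<^esub>g\<in>?A. f g \<oplus>\<^bsub>L\<^esub> f' g)"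
    unfolding x y using car by (intro M.add.finprod_multf[symmetric]) auto
  also have "\<dots> = (\<Oplus>\<^bsub>L\<^esub>g\<in>?A. ?s g)"
    using car by (intro M.add.finprod_cong') auto
  finally have "decomposes ?s (x \<oplus>\<^bsub>L\<^esub> y)"
    using fin car mem by (intro decomposesI[of _ ?A]) (auto simp: component_add_closed)
  then show ?case using f(2) f'(2) by (intro exI[of _ ?s] conjI ballI) (assumption, auto)
qed

text \<open>Otherwise the element would have two decompositions, one without a term in degree \<open>g\<close> and one
  with a term in degree \<open>g\<close> alone, so by uniqueness all its terms vanish.\<close>

lemma homogeneous_in_graded_part:
  assumes "x \<in> graded_part H" "H \<subseteq> carrier G" "g \<in> carrier G" "x \<in> \<Gamma> g" "x \<noteq> \<zero>\<^bsub>L\<^esub>"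
  shows "g \<in> H"
proof (rule ccontr)
  assume "g \<notin> H"
  have x: "x \<in> carrier L" using assms component_closed by blast
  obtain f where f: "decomposes f x" "\<forall>g \<in> carrier G - H. f g = \<zero>\<^bsub>L\<^esub>"
    using graded_part_decomposition[OF assms(1,2)] by blast
  have "x \<in> graded_part {g}" using assms by (auto intro: graded_part.hom)
  then obtain f' where f': "decomposes f' x" "\<forall>h \<in> carrier G - {g}. f' h = \<zero>\<^bsub>L\<^esub>"
    using graded_part_decomposition[of x "{g}"] assms by blast
  have "f = f'" using decomposes_unique[OF x f(1) f'(1)] .
  with f(2) f'(2) \<open>g \<notin> H\<close> have "f h = \<zero>\<^bsub>L\<^esub>" if "h \<in> carrier G" for h
    using that by (cases "h = g") auto
  then have none: "{g \<in> carrier G. f g \<noteq> \<zero>\<^bsub>L\<^esub>} = {}" by blast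
  have "x = (\<Oplus>\<^bsub>L\<^esub>g\<in>{g \<in> carrier G. f g \<noteq> \<zero>\<^bsub>L\<^esub>}. f g)"
    using f(1) by (simp only: decomposes_def)
  then have "x = \<zero>\<^bsub>L\<^esub>" unfolding none by simp
  with assms show False by blast
qed

lemma degree_unique:
  assumes "g \<in> carrier G" "h \<in> carrier G" "x \<in> \<Gamma> g" "x \<in> \<Gamma> h" "x \<noteq> \<zero>\<^bsub>L\<^esub>"
  shows "g = h"
  using homogeneous_in_graded_part[of x "{h}" g] assms by (auto intro: graded_part.hom)

lemma carrier_eq_graded_part: "carrier L = graded_part (carrier G)"
proof (intro equalityI subsetI)
  fix x assume x: "x \<in> carrier L"
  obtain f where f: "f \<in> (\<Pi>\<^sub>E g\<in>carrier G. \<Gamma> g)" and fin: "finite {g \<in> carrier G. f g \<noteq> \<zero>\<^bsub>L\<^esub>}"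
    and eq: "x = (\<Oplus>\<^bsub>L\<^esub>g\<in>{g \<in> carrier G. f g \<noteq> \<zero>\<^bsub>L\<^esub>}. f g)"
    using direct_sum[OF x] by blast
  have "finite A \<Longrightarrow> A \<subseteq> carrier G \<Longrightarrow> (\<Oplus>\<^bsub>L\<^esub>g\<in>A. f g) \<in> graded_part (carrier G)" for A
  proof (induction A rule: finite_induct)
    case empty
    then show ?case by (simp add: graded_part.zero)
  next
    case (insert g A)
    have "f \<in> insert g A \<rightarrow> carrier L" using f insert component_closed by fastforce
    then have "(\<Oplus>\<^bsub>L\<^esub>g\<in>insert g A. f g) = f g \<oplus>\<^bsub>L\<^esub> (\<Oplus>\<^bsub>L\<^esub>g\<in>A. f g)"
      using insert by (subst M.finsum_insert) auto
    moreover have "f g \<in> graded_part (carrier G)"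
      using f insert by (auto intro: graded_part.hom)
    ultimately show ?case using insert by (auto intro: graded_part.add)
  qed
  from this[OF fin] show "x \<in> graded_part (carrier G)" using eq by auto
qed (use graded_part_closed in auto)

lemma graded_part_smult:
  assumes "x \<in> graded_part H" "H \<subseteq> carrier G" "c \<in> carrier K"
  shows "c \<odot>\<^bsub>L\<^esub> x \<in> graded_part H"
  using assms
  by induction (auto simp: smult_r_null smult_r_distr graded_part_closed
      intro: graded_part.intros component_smult_closed)

lemma graded_part_bracket:
  assumes H: "subgroup H G" and x: "x \<in> graded_part H" and y: "y \<in> graded_part H"
  shows "x \<otimes>\<^bsub>L\<^esub> y \<in> graded_part H"
proof -
  have sub: "H \<subseteq> carrier G" using H by (rule subgroup.subset)
  note car = graded_part_closed[OF _ sub] component_closed[OF subsetD[OF sub]]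
  have hom_bracket: "u \<otimes>\<^bsub>L\<^esub> y \<in> graded_part H" if h: "h \<in> H" "u \<in> \<Gamma> h" for h u
    using y
  proof induction
    case zero
    then show ?case using car(2) h by (simp add: bracket_zero_right graded_part.zero)
  next
    case (hom k y)
    have "u \<otimes>\<^bsub>L\<^esub> y \<in> \<Gamma> (h \<otimes>\<^bsub>G\<^esub> k)" using hom h sub by (intro bracket_component) auto
    then show ?case using subgroup.m_closed[OF H h(1) hom(1)] by (rule graded_part.hom[rotated])
  next
    case (add y z)
    then show ?case using h by (auto simp: bracket_add_right car intro: graded_part.add)
  qed
  show ?thesis using x
  proof induction
    case zero
    then show ?case using car(1)[OF y] by (simp add: bracket_zero_left graded_part.zero)
  next
    case (hom h x)
    then show ?case using hom_bracket by blast
  next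
    case (add u z)
    then show ?case using y by (auto simp: bracket_add_left car intro: graded_part.add)
  qed
qed

text \<open>Degrees of brackets are products, so a multiplicatively closed set of degrees gives a subalgebra.\<close>

lemma graded_part_subalgebra:
  assumes H: "subgroup H G" shows "lie_subalgebra K L (graded_part H)"
  using graded_part_closed graded_part_smult graded_part_bracket[OF H] subgroup.subset[OF H]
  unfolding lie_subalgebra_def subspace_def submodule_def
  by (auto simp: vectorspace_axioms module_axioms intro: graded_part.intros)

section \<open>Commutativity of the support\<close>

text \<open>The ideal generated by the component of degree \<open>a\<close>. Brackets with homogeneous elements suffice
  (\<open>component_ideal_is_ideal\<close>), and they are what the induction in \<open>degree_commutes\<close> needs.\<close>

inductive_set component_ideal for a where
  base: "x \<in> \<Gamma> a \<Longrightarrow> x \<in> component_ideal a"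
| add: "x \<in> component_ideal a \<Longrightarrow> y \<in> component_ideal a \<Longrightarrow> x \<oplus>\<^bsub>L\<^esub> y \<in> component_ideal a"
| bracket: "g \<in> carrier G \<Longrightarrow> y \<in> \<Gamma> g \<Longrightarrow> x \<in> component_ideal a \<Longrightarrow> y \<otimes>\<^bsub>L\<^esub> x \<in> component_ideal a"

lemma component_ideal_closed:
  assumes "x \<in> component_ideal a" "a \<in> carrier G" shows "x \<in> carrier L"
  using assms by induction (auto simp: component_closed bracket_closed)

lemma component_ideal_is_ideal:
  assumes a: "a \<in> carrier G"
  shows "lie_ideal K L (component_ideal a)"
proof -
  have zero_mem: "\<zero>\<^bsub>L\<^esub> \<in> component_ideal a" using zero_in_component[OF a] by (rule component_ideal.base)
  have smult: "c \<odot>\<^bsub>L\<^esub> x \<in> component_ideal a" if "x \<in> component_ideal a" "c \<in> carrier K" for c x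
    using that
  proof induction
    case (base x)
    then show ?case using a by (auto intro: component_ideal.base component_smult_closed)
  next
    case (add x y)
    then show ?case using a by (auto simp: smult_r_distr component_ideal_closed intro: component_ideal.add)
  next
    case (bracket g y x)
    then have "y \<otimes>\<^bsub>L\<^esub> (c \<odot>\<^bsub>L\<^esub> x) \<in> component_ideal a" by (auto intro: component_ideal.bracket)
    then show ?case using bracket a
      by (simp add: bracket_smult_right component_closed component_ideal_closed)
  qed
  have "u \<otimes>\<^bsub>L\<^esub> x \<in> component_ideal a" if u: "u \<in> carrier L" and x: "x \<in> component_ideal a" for u x
    using u unfolding carrier_eq_graded_part
  proof induction
    case zero
    then show ?case using zero_mem bracket_zero_left[OF component_ideal_closed[OF x a]] by simp
  next
    case (hom h u)
    then show ?case using x by (auto intro: component_ideal.bracket)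
  next
    case (add u v)
    then have "u \<in> carrier L" "v \<in> carrier L" by (simp_all add: carrier_eq_graded_part)
    then show ?case using add x a
      by (auto simp: bracket_add_left component_ideal_closed intro: component_ideal.add)
  qed
  then show ?thesis
    using zero_mem smult component_ideal_closed[OF _ a]
    unfolding lie_ideal_def subspace_def submodule_def
    by (auto simp: vectorspace_axioms module_axioms intro: component_ideal.add)
qed

text \<open>For \<open>w\<close> of degree \<open>a\<close>, the nonzero elements \<open>[y, w]\<close> and \<open>[w, y]\<close> agree up to sign, so the degrees
  \<open>ba\<close> and \<open>ab\<close> coincide. For \<open>[y, [u, w]]\<close> with \<open>w\<close> already treated, the degree \<open>g\<close> of \<open>u\<close> commutes
  with \<open>a\<close>, and by the Jacobi identity \<open>y\<close> or \<open>[y, u]\<close> acts nontrivially on \<open>w\<close>; so \<open>b\<close> or \<open>bg\<close>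
  commutes with \<open>a\<close>, and either way \<open>b\<close> does.\<close>

lemma degree_commutes:
  assumes a: "a \<in> carrier G"
    and w: "w \<in> component_ideal a" and b: "b \<in> carrier G" "y \<in> \<Gamma> b" and nz: "y \<otimes>\<^bsub>L\<^esub> w \<noteq> \<zero>\<^bsub>L\<^esub>"
  shows "b \<in> centralizer G {a}"
  using w b nz
proof (induction arbitrary: b y)
  case (base w)
  have car: "w \<in> carrier L" "y \<in> carrier L" using base a component_closed by auto
  have "y \<otimes>\<^bsub>L\<^esub> w \<in> \<Gamma> (b \<otimes>\<^bsub>G\<^esub> a)" using base a by (intro bracket_component)
  moreover have "y \<otimes>\<^bsub>L\<^esub> w \<in> \<Gamma> (a \<otimes>\<^bsub>G\<^esub> b)"
  proof -
    have "\<ominus>\<^bsub>K\<^esub> \<one>\<^bsub>K\<^esub> \<odot>\<^bsub>L\<^esub> (w \<otimes>\<^bsub>L\<^esub> y) \<in> \<Gamma> (a \<otimes>\<^bsub>G\<^esub> b)"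
      using base a by (intro component_smult_closed bracket_component) auto
    then show ?thesis
      using bracket_antisym[OF car(2,1)] bracket_closed[OF car] by (simp add: smult_minus_1)
  qed
  ultimately have "b \<otimes>\<^bsub>G\<^esub> a = a \<otimes>\<^bsub>G\<^esub> b" using base a by (intro degree_unique) auto
  then show ?case using base by (simp add: centralizer_def)
next
  case (add w z)
  have "y \<in> carrier L" using add component_closed by blast
  then have "y \<otimes>\<^bsub>L\<^esub> w \<noteq> \<zero>\<^bsub>L\<^esub> \<or> y \<otimes>\<^bsub>L\<^esub> z \<noteq> \<zero>\<^bsub>L\<^esub>"
    using add.prems(3) bracket_add_right[of y w z] add.hyps component_ideal_closed[OF _ a] by auto
  then show ?case using add by blast
next
  case (bracket g u w)
  interpret C: subgroup "centralizer G {a}" G using a by (intro grp.centralizer_subgroup) auto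
  have car: "y \<in> carrier L" "u \<in> carrier L" "w \<in> carrier L"
    using bracket component_closed component_ideal_closed[OF _ a] by auto
  then have "u \<otimes>\<^bsub>L\<^esub> w \<noteq> \<zero>\<^bsub>L\<^esub>" using bracket.prems(3) bracket_zero_right by auto
  then have g: "g \<in> centralizer G {a}" using bracket.IH bracket.hyps by blast
  show ?case
  proof (cases "y \<otimes>\<^bsub>L\<^esub> w = \<zero>\<^bsub>L\<^esub>")
    case True
    then have "(y \<otimes>\<^bsub>L\<^esub> u) \<otimes>\<^bsub>L\<^esub> w \<noteq> \<zero>\<^bsub>L\<^esub>"
      using bracket.prems(3) bracket_bracket_eq_zero[OF car] by blast
    moreover have "y \<otimes>\<^bsub>L\<^esub> u \<in> \<Gamma> (b \<otimes>\<^bsub>G\<^esub> g)" using bracket by (intro bracket_component)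
    ultimately have "b \<otimes>\<^bsub>G\<^esub> g \<in> centralizer G {a}"
      using bracket.IH[of "b \<otimes>\<^bsub>G\<^esub> g"] bracket by auto
    then have "b \<otimes>\<^bsub>G\<^esub> g \<otimes>\<^bsub>G\<^esub> inv\<^bsub>G\<^esub> g \<in> centralizer G {a}" using g by auto
    then show ?thesis using bracket by (simp add: grp.m_assoc)
  next
    case False
    then show ?thesis using bracket by blast
  qed
qed

text \<open>A bracket that extends the ideal is zero or adds a homogeneous factor whose degree commutes with
  \<open>a\<close>, by \<open>degree_commutes\<close>.\<close>

lemma component_ideal_in_centralizer_part:
  assumes a: "a \<in> carrier G" and w: "w \<in> component_ideal a"
  shows "w \<in> graded_part (centralizer G {a})"
  using w
proof induction
  case (base x)
  then show ?case using a by (intro graded_part.hom[of a]) (auto simp: centralizer_def)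
next
  case (add x y)
  then show ?case by (intro graded_part.add)
next
  case (bracket g y x)
  show ?case
  proof (cases "y \<otimes>\<^bsub>L\<^esub> x = \<zero>\<^bsub>L\<^esub>")
    case True
    then show ?thesis by (simp add: graded_part.zero)
  next
    case False
    then have "g \<in> centralizer G {a}" using degree_commutes[OF a] bracket by blast
    then have "y \<in> graded_part (centralizer G {a})" using bracket by (auto intro: graded_part.hom)
    then show ?thesis
      using bracket a by (intro graded_part_bracket grp.centralizer_subgroup) auto
  qed
qed

text \<open>The two conditions on \<open>N\<close> work together: by the second, the homogeneous elements whose degree does
  not commute with \<open>a\<close> are absorbed by \<open>N\<close> and an ideal in commuting degrees; by the first, what is
  absorbed by \<open>N\<close> can be ignored.\<close>

theorem support_commutes:
  assumes N: "\<And>x y. x \<in> N \<Longrightarrow> y \<in> N \<Longrightarrow> x \<oplus>\<^bsub>L\<^esub> y \<in> N" "\<zero>\<^bsub>L\<^esub> \<in> N" "N \<subseteq> carrier L"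
    and frattini: "\<And>S. lie_subalgebra K L S \<Longrightarrow>
      (\<And>x. x \<in> carrier L \<Longrightarrow> \<exists>s \<in> S. \<exists>z \<in> N. x = s \<oplus>\<^bsub>L\<^esub> z) \<Longrightarrow> S = carrier L"
    and annihilator: "\<And>I c. lie_ideal K L I \<Longrightarrow> \<not> I \<subseteq> N \<Longrightarrow> c \<in> carrier L \<Longrightarrow>
      (\<And>x. x \<in> I \<Longrightarrow> c \<otimes>\<^bsub>L\<^esub> x = \<zero>\<^bsub>L\<^esub>) \<Longrightarrow> \<exists>s \<in> I. \<exists>z \<in> N. c = s \<oplus>\<^bsub>L\<^esub> z"
    and a: "a \<in> grading_support G L \<Gamma>" and b: "b \<in> grading_support G L \<Gamma>"
  shows "a \<otimes>\<^bsub>G\<^esub> b = b \<otimes>\<^bsub>G\<^esub> a"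
proof -
  let ?S = "grading_support G L \<Gamma>"
  have S: "?S \<subseteq> carrier G" by (auto simp: grading_support_def)
  \<comment> \<open>To see that a subgroup contains the support, look at homogeneous elements modulo \<open>N\<close> only.\<close>
  have full: "?S \<subseteq> H"
    if H: "subgroup H G" and split: "\<And>g x. g \<in> carrier G \<Longrightarrow> x \<in> \<Gamma> g \<Longrightarrow>
        \<exists>s \<in> graded_part H. \<exists>z \<in> N. x = s \<oplus>\<^bsub>L\<^esub> z" for H
  proof
    have sub: "H \<subseteq> carrier G" using H by (rule subgroup.subset)
    have "\<exists>s \<in> graded_part H. \<exists>z \<in> N. x = s \<oplus>\<^bsub>L\<^esub> z" if x: "x \<in> carrier L" for x
      using x unfolding carrier_eq_graded_part
    proof induction
      case zero
      show ?case using N(2) by (intro bexI[of _ "\<zero>\<^bsub>L\<^esub>"]) (auto intro: graded_part.zero)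
    next
      case (hom h x)
      then show ?case by (rule split)
    next
      case (add x y)
      then obtain s z s' z' where sz: "s \<in> graded_part H" "z \<in> N" "x = s \<oplus>\<^bsub>L\<^esub> z"
        "s' \<in> graded_part H" "z' \<in> N" "y = s' \<oplus>\<^bsub>L\<^esub> z'" by blast
      have "x \<oplus>\<^bsub>L\<^esub> y = (s \<oplus>\<^bsub>L\<^esub> s') \<oplus>\<^bsub>L\<^esub> (z \<oplus>\<^bsub>L\<^esub> z')"
        using sz graded_part_closed[OF _ sub] N(3) by (auto simp: M.a_ac subsetD)
      then show ?case using sz N(1) by (meson graded_part.add)
    qed
    then have eq: "graded_part H = carrier L"
      using graded_part_subalgebra[OF H] by (intro frattini)
    fix g assume g: "g \<in> ?S"
    then have gG: "g \<in> carrier G" by (simp add: grading_support_def)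
    from g obtain x where x: "x \<in> \<Gamma> g" "x \<noteq> \<zero>\<^bsub>L\<^esub>"
      using zero_in_component[OF gG] by (auto simp: grading_support_def)
    with homogeneous_in_graded_part[of x H g] eq sub gG component_closed
    show "g \<in> H" by blast
  qed
  have central: "?S \<subseteq> centralizer G {g}" if g: "g \<in> carrier G" "\<not> \<Gamma> g \<subseteq> N" for g
  proof (rule full)
    show "subgroup (centralizer G {g}) G" using g by (intro grp.centralizer_subgroup) auto
    fix h x assume h: "h \<in> carrier G" "x \<in> \<Gamma> h"
    have x: "x \<in> carrier L" using h component_closed by blast
    show "\<exists>s \<in> graded_part (centralizer G {g}). \<exists>z \<in> N. x = s \<oplus>\<^bsub>L\<^esub> z"
    proof (cases "h \<in> centralizer G {g}")
      case True
      then show ?thesis using h x N(2)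
        by (intro bexI[of _ x] bexI[of _ "\<zero>\<^bsub>L\<^esub>"]) (auto intro: graded_part.hom)
    next
      case False
      then have "x \<otimes>\<^bsub>L\<^esub> w = \<zero>\<^bsub>L\<^esub>" if "w \<in> component_ideal g" for w
        using degree_commutes[OF g(1) that h] by blast
      moreover have "\<not> component_ideal g \<subseteq> N" using g(2) component_ideal.base by blast
      ultimately have "\<exists>s \<in> component_ideal g. \<exists>z \<in> N. x = s \<oplus>\<^bsub>L\<^esub> z"
        using annihilator[OF component_ideal_is_ideal[OF g(1)]] x by blast
      then show ?thesis using component_ideal_in_centralizer_part[OF g(1)] by blast
    qed
  qed
  \<comment> \<open>The components inside \<open>N\<close>, about which \<open>central\<close> says nothing, do no harm to generation.\<close>
  have "?S \<subseteq> centralizer G ?S"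
  proof (rule full)
    show "subgroup (centralizer G ?S) G" using S by (rule grp.centralizer_subgroup)
    fix h x assume h: "h \<in> carrier G" "x \<in> \<Gamma> h"
    have x: "x \<in> carrier L" using h component_closed by blast
    show "\<exists>s \<in> graded_part (centralizer G ?S). \<exists>z \<in> N. x = s \<oplus>\<^bsub>L\<^esub> z"
    proof (cases "\<Gamma> h \<subseteq> N")
      case True
      then show ?thesis using h x
        by (intro bexI[of _ "\<zero>\<^bsub>L\<^esub>"] bexI[of _ x]) (auto intro: graded_part.zero)
    next
      case False
      from central[OF h(1) this] have "h \<in> centralizer G ?S"
        using h(1) by (auto simp: centralizer_def)
      then show ?thesis using h x N(2)
        by (intro bexI[of _ x] bexI[of _ "\<zero>\<^bsub>L\<^esub>"]) (auto intro: graded_part.hom)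
    qed
  qed
  with a b show ?thesis by (auto simp: centralizer_def)
qed

end

section \<open>Block structure as a step function on indices\<close>

text \<open>The number of the block that contains the index \<open>i\<close>. With this function a matrix is block
  upper triangular iff its entries \<open>(i, j)\<close> vanish when the block of \<open>j\<close> comes before that of \<open>i\<close>, and
  all later arguments use only that it is monotone and grows by steps of at most one.\<close>

definition block_index :: "nat list \<Rightarrow> nat \<Rightarrow> nat" where
  "block_index ns i = (LEAST k. i < sum_list (take (Suc k) ns))"

lemma sum_list_take_mono:
  fixes ns :: "nat list"
  assumes "k \<le> l" shows "sum_list (take k ns) \<le> sum_list (take l ns)"
proof -
  obtain d where "l = k + d" using assms le_Suc_ex by blast
  then show ?thesis by (simp add: take_add)
qed

lemma block_index_eq:
  assumes "i \<in> block ns k" shows "block_index ns i = k"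
  unfolding block_index_def
proof (rule Least_equality)
  show "i < sum_list (take (Suc k) ns)" using assms by (simp add: block_def)
next
  fix l assume "i < sum_list (take (Suc l) ns)"
  moreover have "sum_list (take k ns) \<le> i" using assms by (simp add: block_def)
  ultimately show "k \<le> l" using sum_list_take_mono[of "Suc l" k ns] by linarith
qed

lemma less_sum_list_take_block_index:
  assumes "i < sum_list ns" shows "i < sum_list (take (Suc (block_index ns i)) ns)"
  unfolding block_index_def by (rule LeastI[of _ "length ns"]) (use assms in simp)

lemma block_index_mono:
  assumes "i \<le> j" "j < sum_list ns" shows "block_index ns i \<le> block_index ns j"
  unfolding block_index_def[of ns i]
  by (rule Least_le) (use assms less_sum_list_take_block_index[of j ns] in linarith)

text \<open>Blocks are nonempty, so none is skipped when the index grows by one.\<close>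

lemma block_index_Suc:
  assumes pos: "\<forall>m \<in> set ns. m \<ge> 1" and i: "Suc i < sum_list ns"
  shows "block_index ns (Suc i) \<le> Suc (block_index ns i)"
proof -
  define k where "k = block_index ns i"
  have ik: "i < sum_list (take (Suc k) ns)"
    using i less_sum_list_take_block_index[of i ns] by (simp add: k_def)
  have "Suc i < sum_list (take (Suc (Suc k)) ns)"
  proof (cases "Suc k < length ns")
    case True
    then have "1 \<le> ns ! Suc k" using pos by simp
    then show ?thesis using ik True by (simp add: take_Suc_conv_app_nth[of "Suc k"])
  next
    case False
    then show ?thesis using i by simp
  qed
  then show ?thesis unfolding k_def[symmetric] block_index_def[of ns "Suc i"] by (rule Least_le)
qed

text \<open>A discrete intermediate value argument.\<close>

lemma exists_next_block_index:
  assumes pos: "\<forall>m \<in> set ns. m \<ge> 1"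
    and "p < sum_list ns" "q < sum_list ns" "block_index ns p < block_index ns q"
  shows "\<exists>r < sum_list ns. block_index ns r = Suc (block_index ns p)"
  using assms(3,4)
proof (induction q)
  case 0
  then show ?case using block_index_mono[of 0 p ns] assms(2) by simp
next
  case (Suc q)
  show ?case
  proof (cases "block_index ns p < block_index ns q")
    case True
    then show ?thesis using Suc by simp
  next
    case False
    then have "block_index ns (Suc q) = Suc (block_index ns p)"
      using block_index_Suc[OF pos Suc.prems(1)] Suc.prems(2) by linarith
    then show ?thesis using Suc.prems(1) by blast
  qed
qed

lemma block_upper_triangular_iff:
  "A \<in> block_upper_triangular ns \<longleftrightarrow> A \<in> carrier_mat (sum_list ns) (sum_list ns) \<and>
    (\<forall>i < sum_list ns. \<forall>j < sum_list ns. block_index ns j < block_index ns i \<longrightarrow> A $$ (i, j) = 0)"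
proof -
  have 1: "A $$ (i, j) = 0"
    if A: "A \<in> block_upper_triangular ns" and ij: "i < sum_list ns" "j < sum_list ns"
      "block_index ns j < block_index ns i" for i j
  proof -
    obtain k l where "k < length ns" "i \<in> block ns k" "l < length ns" "j \<in> block ns l"
      using ex_block ij(1,2) by meson
    then show ?thesis using A ij(3) by (auto simp: block_upper_triangular_def block_index_eq)
  qed
  show ?thesis
    using 1 by (auto simp: block_upper_triangular_def block_index_eq block_entry_less)
qed

lemma UT0_iff:
  "A \<in> carrier (UT0 ns) \<longleftrightarrow> A \<in> carrier_mat (sum_list ns) (sum_list ns) \<and>
    (\<forall>i < sum_list ns. \<forall>j < sum_list ns. block_index ns j < block_index ns i \<longrightarrow> A $$ (i, j) = 0) \<and>
    (\<Sum>i<sum_list ns. A $$ (i, i)) = 0"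
  by (auto simp: UT0_simps block_upper_triangular_iff trace_mat_def)

section \<open>Elementary matrices\<close>

definition elementary :: "nat \<Rightarrow> nat \<Rightarrow> nat \<Rightarrow> 'a :: field mat" where
  "elementary n p q = mat n n (\<lambda>(i, j). if i = p \<and> j = q then 1 else 0)"

lemma elementary_carrier [simp]: "elementary n p q \<in> carrier_mat n n"
  by (simp add: elementary_def)

lemma elementary_dim [simp]: "dim_row (elementary n p q) = n" "dim_col (elementary n p q) = n"
  by (simp_all add: elementary_def)

lemma elementary_index [simp]:
  "i < n \<Longrightarrow> j < n \<Longrightarrow> elementary n p q $$ (i, j) = (if i = p \<and> j = q then 1 else 0)"
  by (simp add: elementary_def)

lemma mult_index:
  assumes "A \<in> carrier_mat n n" "B \<in> carrier_mat n n" "i < n" "j < n"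
  shows "(A * B) $$ (i, j) = (\<Sum>k<n. A $$ (i, k) * B $$ (k, j))"
  using assms by (simp add: scalar_prod_def lessThan_atLeast0)

lemma bracket_elementary_index:
  fixes A :: "'a :: field mat"
  assumes A: "A \<in> carrier_mat n n" and pq: "p < n" "q < n" and ij: "i < n" "j < n"
  shows "(A * elementary n p q - elementary n p q * A) $$ (i, j)
    = (if j = q then A $$ (i, p) else 0) - (if i = p then A $$ (q, j) else 0)"
proof -
  have "(A * elementary n p q) $$ (i, j) = (\<Sum>k<n. if k = p then (if j = q then A $$ (i, p) else 0) else 0)"
    unfolding mult_index[OF A elementary_carrier ij] using pq ij by (intro sum.cong) auto
  moreover have "(elementary n p q * A) $$ (i, j) = (\<Sum>k<n. if k = q then (if i = p then A $$ (q, j) else 0) else 0)"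
    unfolding mult_index[OF elementary_carrier A ij] using pq ij by (intro sum.cong) auto
  ultimately show ?thesis using assms by (simp del: index_mult_mat(1))
qed

text \<open>Elementary matrices are eigenvectors of the diagonal matrices, with the roots \<open>d i - d j\<close> as
  eigenvalues.\<close>

lemma bracket_diagonal_index:
  fixes x :: "'a :: field mat" and d :: "nat \<Rightarrow> 'a"
  assumes x: "x \<in> carrier_mat n n" and ij: "i < n" "j < n"
  defines "h \<equiv> mat n n (\<lambda>(i, j). if i = j then d i else 0)"
  shows "(h * x - x * h) $$ (i, j) = (d i - d j) * x $$ (i, j)"
proof -
  have h: "h \<in> carrier_mat n n" by (simp add: h_def)
  have "(h * x) $$ (i, j) = (\<Sum>k<n. if k = i then d i * x $$ (i, j) else 0)"
    unfolding mult_index[OF h x ij] using ij by (intro sum.cong) (auto simp: h_def)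
  moreover have "(x * h) $$ (i, j) = (\<Sum>k<n. if k = j then x $$ (i, j) * d j else 0)"
    unfolding mult_index[OF x h ij] using ij by (intro sum.cong) (auto simp: h_def)
  ultimately show ?thesis using x h ij by (simp add: algebra_simps del: index_mult_mat(1))
qed

lemma finite_nonzero_entries: "finite {(i, j). i < n \<and> j < n \<and> P i j}" for n :: nat
  by (rule finite_subset[of _ "{..<n} \<times> {..<n}"]) auto

text \<open>The induction removes one nonzero entry at a time. The condition on \<open>T\<close> is weaker than being a
  subspace, but any subspace that contains the relevant elementary matrices satisfies it.\<close>

lemma elementary_span:
  fixes x :: "'a :: field mat"
  assumes zero: "0\<^sub>m n n \<in> T"
    and add: "\<And>y c p q. y \<in> T \<Longrightarrow> p < n \<Longrightarrow> q < n \<Longrightarrow> P p q \<Longrightarrow> y + c \<cdot>\<^sub>m elementary n p q \<in> T"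
    and x: "x \<in> carrier_mat n n" "\<And>p q. p < n \<Longrightarrow> q < n \<Longrightarrow> x $$ (p, q) \<noteq> 0 \<Longrightarrow> P p q"
  shows "x \<in> T"
  using x
proof (induction "card {(i, j). i < n \<and> j < n \<and> x $$ (i, j) \<noteq> 0}" arbitrary: x rule: less_induct)
  case less
  show ?case
  proof (cases "\<exists>p < n. \<exists>q < n. x $$ (p, q) \<noteq> 0")
    case True
    then obtain p q where pq: "p < n" "q < n" "x $$ (p, q) \<noteq> 0" by blast
    define y where "y = x - x $$ (p, q) \<cdot>\<^sub>m elementary n p q"
    have y_index: "y $$ (i, j) = (if i = p \<and> j = q then 0 else x $$ (i, j))"
      if "i < n" "j < n" for i j
      using that less.prems(1) by (auto simp: y_def)
    have "{(i, j). i < n \<and> j < n \<and> y $$ (i, j) \<noteq> 0} \<subset> {(i, j). i < n \<and> j < n \<and> x $$ (i, j) \<noteq> 0}"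
    proof
      show "{(i, j). i < n \<and> j < n \<and> y $$ (i, j) \<noteq> 0} \<subseteq> {(i, j). i < n \<and> j < n \<and> x $$ (i, j) \<noteq> 0}"
        using y_index by (auto split: if_splits)
      have "(p, q) \<notin> {(i, j). i < n \<and> j < n \<and> y $$ (i, j) \<noteq> 0}" using pq y_index by simp
      then show "{(i, j). i < n \<and> j < n \<and> y $$ (i, j) \<noteq> 0} \<noteq> {(i, j). i < n \<and> j < n \<and> x $$ (i, j) \<noteq> 0}"
        using pq by blast
    qed
    then have "card {(i, j). i < n \<and> j < n \<and> y $$ (i, j) \<noteq> 0}
        < card {(i, j). i < n \<and> j < n \<and> x $$ (i, j) \<noteq> 0}"
      by (intro psubset_card_mono finite_nonzero_entries)
    moreover have "P i j" if "i < n" "j < n" "y $$ (i, j) \<noteq> 0" for i j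
      using that less.prems(2) y_index by (auto split: if_splits)
    moreover have "y \<in> carrier_mat n n"
      unfolding y_def by (intro minus_carrier_mat smult_carrier_mat elementary_carrier)
    ultimately have "y \<in> T" using less.hyps[of y] by blast
    then have "y + x $$ (p, q) \<cdot>\<^sub>m elementary n p q \<in> T" using pq less.prems(2) by (intro add)
    moreover have "y + x $$ (p, q) \<cdot>\<^sub>m elementary n p q = x"
      using less.prems(1) by (intro eq_matI) (auto simp: y_def)
    ultimately show ?thesis by simp
  next
    case False
    then have "x = 0\<^sub>m n n" using less.prems(1) by (intro eq_matI) auto
    then show ?thesis using zero by simp
  qed
qed

section \<open>Ideals of the trace-zero block-triangular matrices\<close>

lemma lie_ideal_UT0:
  fixes I :: "'a :: field mat set"
  assumes I: "lie_ideal class_ring (UT0 ns) I"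
  shows "I \<subseteq> carrier (UT0 ns)" "0\<^sub>m (sum_list ns) (sum_list ns) \<in> I"
    "\<And>x y. x \<in> I \<Longrightarrow> y \<in> I \<Longrightarrow> x + y \<in> I" "\<And>c x. x \<in> I \<Longrightarrow> c \<cdot>\<^sub>m x \<in> I"
    "\<And>u x. u \<in> carrier (UT0 ns) \<Longrightarrow> x \<in> I \<Longrightarrow> u * x - x * u \<in> I"
  using I unfolding lie_ideal_def subspace_def submodule_def
  by (auto simp: UT0_simps class_ring_simps)

lemma UT0_carrier_mat: "x \<in> carrier (UT0 ns) \<Longrightarrow> x \<in> carrier_mat (sum_list ns) (sum_list ns)"
  by (simp add: UT0_iff)

lemma elementary_in_UT0:
  assumes "p \<noteq> q" "block_index ns p \<le> block_index ns q"
  shows "elementary (sum_list ns) p q \<in> carrier (UT0 ns)"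
  using assms by (auto simp: UT0_iff intro!: sum.neutral)

lemma elementary_in_UT0_D:
  assumes "elementary (sum_list ns) p q \<in> carrier (UT0 ns)" "p < sum_list ns" "q < sum_list ns"
  shows "block_index ns p \<le> block_index ns q"
  using assms by (force simp: UT0_iff)

text \<open>The value at the pair \<open>(i, j)\<close> is the eigenvalue of \<open>E\<^sub>k\<^sub>k\<close> on \<open>E\<^sub>i\<^sub>j\<close>: already a single one of these
  diagonal matrices tells the root at \<open>(p, q)\<close> from the eigenvalue at any other position. The case
  \<open>(r, t) = (q, p)\<close> needs \<open>1 \<noteq> -1\<close>.\<close>

lemma separate_roots:
  fixes p q r t :: nat
  assumes "p \<noteq> q" "(r, t) \<noteq> (p, q)"
  obtains k where "k = p \<or> k = q"
    "of_bool (p = k) - of_bool (q = k) \<noteq> (of_bool (r = k) - of_bool (t = k) :: 'a :: field_char_0)"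
proof (cases "r = p")
  case True
  then have "of_bool (p = q) - of_bool (q = q) \<noteq> (of_bool (r = q) - of_bool (t = q) :: 'a)"
    using assms by auto
  then show ?thesis using that by blast
next
  case False
  have "(1 :: 'a) \<noteq> -1" by simp
  then have "of_bool (p = p) - of_bool (q = p) \<noteq> (of_bool (r = p) - of_bool (t = p) :: 'a)"
    using assms False by (cases "t = p") auto
  then show ?thesis using that by blast
qed

text \<open>Root space decomposition of an ideal, done by elimination: with a suitable diagonal matrix \<open>h\<close>, the
  operation \<open>[h, x] - \<mu> x\<close> kills a chosen other entry of \<open>x\<close> and only rescales the remaining ones, the
  entry at \<open>(p, q)\<close> by a nonzero factor. When no other entry is left, \<open>x\<close> is a multiple of the elementary
  matrix.\<close>

lemma ideal_contains_elementary:
  fixes I :: "'a :: field_char_0 mat set"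
  assumes I: "lie_ideal class_ring (UT0 ns) I" and x: "x \<in> I"
    and pq: "p < sum_list ns" "q < sum_list ns" "p \<noteq> q" "x $$ (p, q) \<noteq> 0"
  shows "elementary (sum_list ns) p q \<in> I"
  using x pq(4)
proof (induction "card {(i, j). i < sum_list ns \<and> j < sum_list ns \<and> x $$ (i, j) \<noteq> 0}"
    arbitrary: x rule: less_induct)
  case less
  let ?n = "sum_list ns"
  note ideal = lie_ideal_UT0[OF I]
  have x: "x \<in> carrier_mat ?n ?n" using less.prems ideal(1) UT0_carrier_mat by blast
  show ?case
  proof (cases "\<exists>r < ?n. \<exists>t < ?n. (r, t) \<noteq> (p, q) \<and> x $$ (r, t) \<noteq> 0")
    case True
    then obtain r t where rt: "r < ?n" "t < ?n" "(r, t) \<noteq> (p, q)" "x $$ (r, t) \<noteq> 0" by blast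
    obtain k where k: "k = p \<or> k = q"
      "of_bool (p = k) - of_bool (q = k) \<noteq> (of_bool (r = k) - of_bool (t = k) :: 'a)"
      using separate_roots[OF pq(3) rt(3)] by metis
    have kn: "k < ?n" using k(1) pq by blast
    \<comment> \<open>The scalar \<open>1 / n\<close> makes \<open>h\<close> traceless and does not change its brackets.\<close>
    define d :: "nat \<Rightarrow> 'a" where "d i = of_bool (i = k) - 1 / of_nat ?n" for i
    define h :: "'a mat" where "h = mat ?n ?n (\<lambda>(i, j). if i = j then d i else 0)"
    have "(\<Sum>i<?n. d i) = 0"
      using kn by (simp add: d_def sum_subtractf of_bool_def del: sum_list_eq_0_iff)
    then have hL: "h \<in> carrier (UT0 ns)" by (auto simp: UT0_iff h_def)
    then have hc: "h \<in> carrier_mat ?n ?n" by (rule UT0_carrier_mat)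
    define \<mu> where "\<mu> = d r - d t"
    define y where "y = (h * x - x * h) + (- \<mu>) \<cdot>\<^sub>m x"
    have yI: "y \<in> I" unfolding y_def using less.prems hL by (intro ideal(3,4,5))
    have y_index: "y $$ (i, j) = (d i - d j - \<mu>) * x $$ (i, j)" if ij: "i < ?n" "j < ?n" for i j
      using bracket_diagonal_index[OF x ij, of d] x hc ij
      by (simp add: y_def h_def algebra_simps del: index_mult_mat(1))
    have "d p - d q - \<mu> \<noteq> 0" using k(2) by (simp add: d_def \<mu>_def)
    then have ypq: "y $$ (p, q) \<noteq> 0" using y_index[of p q] pq less.prems by simp
    have "{(i, j). i < ?n \<and> j < ?n \<and> y $$ (i, j) \<noteq> 0} \<subset> {(i, j). i < ?n \<and> j < ?n \<and> x $$ (i, j) \<noteq> 0}"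
    proof
      show "{(i, j). i < ?n \<and> j < ?n \<and> y $$ (i, j) \<noteq> 0} \<subseteq> {(i, j). i < ?n \<and> j < ?n \<and> x $$ (i, j) \<noteq> 0}"
        using y_index by auto
      have "(r, t) \<notin> {(i, j). i < ?n \<and> j < ?n \<and> y $$ (i, j) \<noteq> 0}"
        using y_index rt(1,2) by (simp add: \<mu>_def)
      then show "{(i, j). i < ?n \<and> j < ?n \<and> y $$ (i, j) \<noteq> 0} \<noteq> {(i, j). i < ?n \<and> j < ?n \<and> x $$ (i, j) \<noteq> 0}"
        using rt by blast
    qed
    then have "card {(i, j). i < ?n \<and> j < ?n \<and> y $$ (i, j) \<noteq> 0}
        < card {(i, j). i < ?n \<and> j < ?n \<and> x $$ (i, j) \<noteq> 0}"
      by (intro psubset_card_mono finite_nonzero_entries)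
    then show ?thesis using yI ypq by (rule less.hyps)
  next
    case False
    then have "elementary ?n p q = (1 / x $$ (p, q)) \<cdot>\<^sub>m x"
      using x pq less.prems by (intro eq_matI) auto
    then show ?thesis using ideal(4)[OF less.prems(1)] by simp
  qed
qed

text \<open>The number assumed to be nonzero is the entry at \<open>(i, j)\<close> of \<open>[x, E\<^sub>p\<^sub>q]\<close>.\<close>

lemma ideal_elementary_bracket:
  fixes I :: "'a :: field_char_0 mat set"
  assumes I: "lie_ideal class_ring (UT0 ns) I" and x: "x \<in> I"
    and pq: "p < sum_list ns" "q < sum_list ns" "p \<noteq> q" "block_index ns p \<le> block_index ns q"
    and ij: "i < sum_list ns" "j < sum_list ns" "i \<noteq> j"
    and nz: "(if j = q then x $$ (i, p) else 0) - (if i = p then x $$ (q, j) else 0) \<noteq> 0"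
  shows "elementary (sum_list ns) i j \<in> I"
proof (rule ideal_contains_elementary[OF I _ ij])
  let ?E = "elementary (sum_list ns) p q :: 'a mat"
  note ideal = lie_ideal_UT0[OF I]
  have x': "x \<in> carrier_mat (sum_list ns) (sum_list ns)" using x ideal(1) UT0_carrier_mat by blast
  show "?E * x - x * ?E \<in> I" using x pq by (intro ideal(5) elementary_in_UT0)
  have "(?E * x - x * ?E) $$ (i, j) = - ((x * ?E - ?E * x) $$ (i, j))"
    using x' ij by (simp del: index_mult_mat(1))
  then show "(?E * x - x * ?E) $$ (i, j) \<noteq> 0"
    using nz bracket_elementary_index[OF x' pq(1,2) ij(1,2)] by simp
qed

text \<open>Brackets with elementary matrices move the row index to any block at or before that of \<open>p\<close> and the
  column index to any block at or after that of \<open>q\<close>, as long as the position stays off the diagonal. The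
  only obstructed case is \<open>r = q\<close>, where \<open>p\<close> and \<open>q\<close> share a block. There one first passes from \<open>E\<^sub>p\<^sub>q\<close> to
  \<open>E\<^sub>q\<^sub>p\<close> as in the Lie algebra of trace-zero two-by-two matrices, which works outside characteristic \<open>2\<close>.\<close>

lemma ideal_elementary_upward:
  fixes I :: "'a :: field_char_0 mat set"
  assumes I: "lie_ideal class_ring (UT0 ns) I" and E: "elementary (sum_list ns) p q \<in> I"
    and pq: "p < sum_list ns" "q < sum_list ns" "p \<noteq> q"
    and rt: "r < sum_list ns" "t < sum_list ns" "r \<noteq> t"
    and le: "block_index ns r \<le> block_index ns p" "block_index ns q \<le> block_index ns t"
  shows "elementary (sum_list ns) r t \<in> I"
proof -
  let ?n = "sum_list ns" and ?b = "block_index ns"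
  note ideal = lie_ideal_UT0[OF I]
  have row: "elementary ?n u j \<in> I"
    if "elementary ?n i j \<in> I" "i < ?n" "j < ?n" "u < ?n" "u \<noteq> j" "?b u \<le> ?b i" for i j u
    using that ideal_elementary_bracket[OF I that(1), of u i u j] by (cases "u = i") auto
  have col: "elementary ?n i v \<in> I"
    if "elementary ?n i j \<in> I" "i < ?n" "j < ?n" "v < ?n" "i \<noteq> v" "?b j \<le> ?b v" for i j v
    using that ideal_elementary_bracket[OF I that(1), of j v i v] by (cases "v = j") auto
  have bpq: "?b p \<le> ?b q" using E ideal(1) elementary_in_UT0_D[OF _ pq(1,2)] by blast
  show ?thesis
  proof (cases "r = q")
    case False
    then have "elementary ?n r q \<in> I" using row[OF E] pq rt le by blast
    then show ?thesis using col pq rt le by blast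
  next
    case True
    then have b: "?b p = ?b q" using le bpq by simp
    \<comment> \<open>This is \<open>E\<^sub>q\<^sub>q - E\<^sub>p\<^sub>p\<close>, and bracketing it with \<open>E\<^sub>q\<^sub>p\<close> gives \<open>2 E\<^sub>q\<^sub>p\<close>.\<close>
    define x where "x = elementary ?n q p * elementary ?n p q
      - elementary ?n p q * (elementary ?n q p :: 'a mat)"
    have xI: "x \<in> I" unfolding x_def using E pq b by (intro ideal(5) elementary_in_UT0) auto
    have "x $$ (q, q) = 1" "x $$ (p, p) = -1"
      using pq by (auto simp: x_def bracket_elementary_index
        simp del: index_mult_mat(1) index_minus_mat(1))
    then have "elementary ?n q p \<in> I"
      using pq b by (intro ideal_elementary_bracket[OF I xI, of q p]) auto
    then show ?thesis using True col[of q p t] pq rt le b by auto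
  qed
qed

section \<open>Block superdiagonals\<close>

text \<open>The matrices supported at least \<open>d\<close> blocks above the diagonal. For \<open>d \<ge> 1\<close> this is the \<open>d\<close>-th term
  of the lower central series of the strictly block-triangular matrices; the subspace \<open>N\<close> of the general
  argument is the layer \<open>2\<close>.\<close>

definition layer :: "nat list \<Rightarrow> nat \<Rightarrow> 'a :: field mat set" where
  "layer ns d = {x \<in> carrier (UT0 ns). \<forall>p < sum_list ns. \<forall>q < sum_list ns.
    block_index ns q < block_index ns p + d \<longrightarrow> x $$ (p, q) = 0}"

lemma layer_zero: "0\<^sub>m (sum_list ns) (sum_list ns) \<in> layer ns d"
  by (auto simp: layer_def UT0_iff)

lemma UT0_add: "x \<in> carrier (UT0 ns) \<Longrightarrow> y \<in> carrier (UT0 ns) \<Longrightarrow> x + y \<in> carrier (UT0 ns)"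
  by (auto simp: UT0_iff sum.distrib)

lemma layer_add: "x \<in> layer ns d \<Longrightarrow> y \<in> layer ns d \<Longrightarrow> x + y \<in> layer ns d"
  by (auto simp: layer_def UT0_add dest: UT0_carrier_mat)

lemma UT0_smult: "x \<in> carrier (UT0 ns) \<Longrightarrow> c \<cdot>\<^sub>m x \<in> carrier (UT0 ns)"
  by (auto simp: UT0_iff simp flip: sum_distrib_left)

lemma layer_smult: "x \<in> layer ns d \<Longrightarrow> c \<cdot>\<^sub>m x \<in> layer ns d"
  by (auto simp: layer_def UT0_smult dest: UT0_carrier_mat)

lemma UT0_bracket:
  assumes "x \<in> carrier (UT0 ns)" "y \<in> carrier (UT0 ns)"
  shows "x * y - y * x \<in> carrier (UT0 ns)"
  using lie_algebra.bracket_closed[OF lie_algebra_UT0 assms] by (simp add: UT0_simps(2))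

lemma layer_bracket:
  fixes x y :: "'a :: field mat"
  assumes x: "x \<in> layer ns a" and y: "y \<in> layer ns b"
  shows "x * y - y * x \<in> layer ns (a + b)"
proof -
  let ?n = "sum_list ns" and ?b = "block_index ns"
  have L: "x \<in> carrier (UT0 ns)" "y \<in> carrier (UT0 ns)" using x y by (auto simp: layer_def)
  have prod: "(u * v) $$ (p, q) = 0"
    if "u \<in> layer ns a" "v \<in> layer ns b" "p < ?n" "q < ?n" "?b q < ?b p + (a + b)"
    for u v :: "'a mat" and a b p q
  proof -
    have "u $$ (p, k) * v $$ (k, q) = 0" if k: "k < ?n" for k
    proof (cases "?b k < ?b p + a")
      case True
      then show ?thesis using \<open>u \<in> layer ns a\<close> k \<open>p < ?n\<close> by (auto simp: layer_def)
    next
      case False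
      then have "?b q < ?b k + b" using \<open>?b q < ?b p + (a + b)\<close> by linarith
      then show ?thesis using \<open>v \<in> layer ns b\<close> k \<open>q < ?n\<close> by (auto simp: layer_def)
    qed
    moreover have "u \<in> carrier_mat ?n ?n" "v \<in> carrier_mat ?n ?n"
      using that(1,2) UT0_carrier_mat by (auto simp: layer_def)
    ultimately show ?thesis using mult_index[of u ?n v p q] that(3,4) by (auto intro!: sum.neutral)
  qed
  show ?thesis
    using UT0_bracket[OF L] L[THEN UT0_carrier_mat] prod[OF x y] prod[OF y x]
    by (auto simp: layer_def add.commute simp del: index_mult_mat(1))
qed

lemma elementary_layer:
  assumes "p \<noteq> q" "block_index ns p + d \<le> block_index ns q"
  shows "elementary (sum_list ns) p q \<in> layer ns d"
  using assms elementary_in_UT0[of p q ns] by (auto simp: layer_def)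

lemma layer_trivial:
  assumes k: "\<And>q. q < sum_list ns \<Longrightarrow> block_index ns q < k" and x: "x \<in> layer ns k"
  shows "x = 0\<^sub>m (sum_list ns) (sum_list ns)"
  using x k by (intro eq_matI) (auto simp: layer_def trans_less_add2 dest: UT0_carrier_mat)

text \<open>An elementary matrix on the \<open>k\<close>-th block superdiagonal is a bracket \<open>[e, f]\<close> with \<open>e\<close> in layer \<open>1\<close>
  and \<open>f\<close> in layer \<open>k - 1\<close>. Replacing both factors by elements of \<open>S\<close> that agree with them modulo layer
  \<open>k\<close> changes the bracket only in layer \<open>k + 1\<close>, because layers add up under brackets and \<open>k \<ge> 2\<close>. So the
  error can be pushed from one layer into the next.\<close>

lemma generates_modulo_layer:
  fixes S :: "'a :: field mat set"
  assumes pos: "\<forall>m \<in> set ns. m \<ge> 1"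
    and S: "lie_subalgebra class_ring (UT0 ns) S"
    and S2: "\<And>x. x \<in> carrier (UT0 ns) \<Longrightarrow> \<exists>s \<in> S. \<exists>z \<in> layer ns 2. x = s + z"
    and k: "k \<ge> 2" and x: "x \<in> carrier (UT0 ns)"
  shows "\<exists>s \<in> S. \<exists>z \<in> layer ns k. x = s + z"
  using k x
proof (induction k arbitrary: x rule: dec_induct)
  case base
  then show ?case by (rule S2)
next
  case (step k)
  let ?n = "sum_list ns" and ?b = "block_index ns"
  let ?T = "{s + z | s z. s \<in> S \<and> z \<in> layer ns (Suc k)}"
  have SL: "S \<subseteq> carrier (UT0 ns)" and S0: "0\<^sub>m ?n ?n \<in> S"
    and S_add: "\<And>s t. s \<in> S \<Longrightarrow> t \<in> S \<Longrightarrow> s + t \<in> S"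
    and S_smult: "\<And>c s. s \<in> S \<Longrightarrow> c \<cdot>\<^sub>m s \<in> S"
    and S_bracket: "\<And>s t. s \<in> S \<Longrightarrow> t \<in> S \<Longrightarrow> s * t - t * s \<in> S"
    using S unfolding lie_subalgebra_def subspace_def submodule_def
    by (auto simp: UT0_simps class_ring_simps)
  have car: "s \<in> carrier_mat ?n ?n" if "s \<in> S \<or> s \<in> layer ns d" for s d
    using that SL UT0_carrier_mat by (auto simp: layer_def)
  have T_add: "u + v \<in> ?T" if uv: "u \<in> ?T" "v \<in> ?T" for u v
  proof -
    obtain s z t w where "s \<in> S" "z \<in> layer ns (Suc k)" "u = s + z"
      "t \<in> S" "w \<in> layer ns (Suc k)" "v = t + w" using uv by blast
    moreover from this have "u + v = (s + t) + (z + w)"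
      using car by (intro eq_matI) (auto dest!: car[OF disjI1] car[OF disjI2])
    ultimately show ?thesis using S_add layer_add by blast
  qed
  have T_smult: "c \<cdot>\<^sub>m u \<in> ?T" if u: "u \<in> ?T" for c u
  proof -
    obtain s z where sz: "s \<in> S" "z \<in> layer ns (Suc k)" "u = s + z" using u by blast
    then have "c \<cdot>\<^sub>m u = c \<cdot>\<^sub>m s + c \<cdot>\<^sub>m z" using car add_smult_distrib_left_mat by blast
    then show ?thesis using sz S_smult layer_smult by blast
  qed
  have T_elementary: "elementary ?n p q \<in> ?T"
    if pq: "p < ?n" "q < ?n" "?b p + k \<le> ?b q" for p q
  proof (cases "?b p + Suc k \<le> ?b q")
    case True
    then have "(elementary ?n p q :: 'a mat) \<in> layer ns (Suc k)" by (intro elementary_layer) auto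
    moreover have "(elementary ?n p q :: 'a mat) = 0\<^sub>m ?n ?n + elementary ?n p q" by simp
    ultimately show ?thesis using S0 by blast
  next
    case False
    then have bq: "?b q = ?b p + k" using pq by simp
    obtain r where r: "r < ?n" "?b r = Suc (?b p)"
      using exists_next_block_index[OF pos pq(1,2)] bq step.hyps by auto
    define e :: "'a mat" where "e = elementary ?n p r"
    define f :: "'a mat" where "f = elementary ?n r q"
    have e: "e \<in> layer ns 1" unfolding e_def using r by (intro elementary_layer) auto
    have f: "f \<in> layer ns (k - 1)" unfolding f_def
      using r bq step.hyps by (intro elementary_layer) auto
    obtain s u where s: "s \<in> S" "u \<in> layer ns k" "e = s + u"
      using step.IH[of e] e by (auto simp: layer_def)
    obtain t v where t: "t \<in> S" "v \<in> layer ns k" "f = t + v"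
      using step.IH[of f] f by (auto simp: layer_def)
    have c: "e \<in> carrier_mat ?n ?n" "f \<in> carrier_mat ?n ?n" "s \<in> carrier_mat ?n ?n"
      "t \<in> carrier_mat ?n ?n" "u \<in> carrier_mat ?n ?n" "v \<in> carrier_mat ?n ?n"
      using car s t e f by blast+
    have layer_mono: "layer ns i \<subseteq> (layer ns j :: 'a mat set)" if "j \<le> i" for i j
      using that by (auto simp: layer_def)
    have "s = e + (- 1) \<cdot>\<^sub>m u" using c s(3) by (intro eq_matI) auto
    then have "s \<in> layer ns 1"
      using e s(2) layer_mono[of 1 k] step.hyps by (auto intro!: layer_add layer_smult)
    then have "s * v - v * s \<in> layer ns (Suc k)" using layer_bracket[of s ns 1 v k] t(2) by simp
    moreover have "u * f - f * u \<in> layer ns (Suc k)"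
    proof -
      have "Suc k \<le> k + (k - 1)" using step.hyps by linarith
      then show ?thesis using layer_bracket[OF s(2) f] layer_mono by blast
    qed
    ultimately have tail: "(s * v - v * s) + (u * f - f * u) \<in> layer ns (Suc k)" by (rule layer_add)
    have "e * f - f * e = elementary ?n p q"
      using c r bq pq step.hyps unfolding f_def
      by (intro eq_matI) (auto simp: bracket_elementary_index e_def
        simp del: index_mult_mat(1) index_minus_mat(1))
    moreover have "e * f - f * e = (s * t - t * s) + ((s * v - v * s) + (u * f - f * u))"
    proof -
      have "e * f = s * t + s * v + u * f"
        using c unfolding s(3) by (subst add_mult_distrib_mat[of _ ?n ?n])
          (auto simp: t(3) mult_add_distrib_mat[of _ ?n ?n])
      moreover have "f * e = t * s + v * s + f * u"
        using c unfolding s(3) by (subst mult_add_distrib_mat[of _ ?n ?n])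
          (auto simp: t(3) add_mult_distrib_mat[of _ ?n ?n])
      ultimately show ?thesis
        using c by (intro eq_matI) (auto simp del: index_mult_mat(1))
    qed
    ultimately have "elementary ?n p q = (s * t - t * s) + ((s * v - v * s) + (u * f - f * u))"
      by simp
    then show ?thesis using S_bracket[OF s(1) t(1)] tail by blast
  qed
  have sub: "layer ns k \<subseteq> ?T"
  proof
    fix z :: "'a mat" assume z: "z \<in> layer ns k"
    show "z \<in> ?T"
    proof (rule elementary_span)
      have "0\<^sub>m ?n ?n = 0\<^sub>m ?n ?n + (0\<^sub>m ?n ?n :: 'a mat)" by simp
      then show "0\<^sub>m ?n ?n \<in> ?T" using S0 layer_zero by blast
      show "z \<in> carrier_mat ?n ?n" using z car by blast
      show "?b p + k \<le> ?b q" if "p < ?n" "q < ?n" "z $$ (p, q) \<noteq> 0" for p q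
      proof (rule ccontr)
        assume "\<not> ?thesis"
        then have "?b q < ?b p + k" by simp
        then show False using that z by (simp add: layer_def)
      qed
    qed (intro T_add T_smult T_elementary)
  qed
  obtain s z where sz: "s \<in> S" "z \<in> layer ns k" "x = s + z" using step by blast
  then obtain t w where tw: "t \<in> S" "w \<in> layer ns (Suc k)" "z = t + w" using sub by blast
  then have "x = (s + t) + w"
    using sz car assoc_add_mat[of s ?n ?n t w] by metis
  then show ?case using S_add[OF sz(1) tw(1)] tw(2) by blast
qed

lemma subalgebra_eq_UT0:
  fixes S :: "'a :: field mat set"
  assumes pos: "\<forall>m \<in> set ns. m \<ge> 1"
    and S: "lie_subalgebra class_ring (UT0 ns) S"
    and S2: "\<And>x. x \<in> carrier (UT0 ns) \<Longrightarrow> \<exists>s \<in> S. \<exists>z \<in> layer ns 2. x = s + z"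
  shows "S = carrier (UT0 ns)"
proof
  show sub: "S \<subseteq> carrier (UT0 ns)"
    using S by (auto simp: lie_subalgebra_def subspace_def submodule_def)
  define k where "k = block_index ns (sum_list ns - 1) + 2"
  have k: "block_index ns q < k" if "q < sum_list ns" for q
  proof -
    have "block_index ns q \<le> block_index ns (sum_list ns - 1)"
      using that by (intro block_index_mono) linarith+
    then show ?thesis by (simp add: k_def)
  qed
  show "carrier (UT0 ns) \<subseteq> S"
  proof
    fix x :: "'a mat" assume x: "x \<in> carrier (UT0 ns)"
    have "2 \<le> k" by (simp add: k_def)
    from generates_modulo_layer[OF pos S S2 this x] obtain s z
      where "s \<in> S" "z \<in> layer ns k" "x = s + z" by blast
    moreover from this have "z = 0\<^sub>m (sum_list ns) (sum_list ns)"
      using layer_trivial[OF k] by blast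
    moreover have "s \<in> carrier_mat (sum_list ns) (sum_list ns)"
      using \<open>s \<in> S\<close> sub UT0_carrier_mat by blast
    ultimately show "x \<in> S" by simp
  qed
qed

text \<open>If the entry that keeps an element of \<open>I\<close> out of layer \<open>2\<close> is on the diagonal, then the diagonal is not
  constant, for a constant one would have nonzero trace in characteristic \<open>0\<close>. Two neighbouring
  diagonal entries then differ, and a bracket turns their difference into an entry right above the
  diagonal.\<close>

lemma not_layer_contains_elementary:
  fixes I :: "'a :: field_char_0 mat set"
  assumes pos: "\<forall>m \<in> set ns. m \<ge> 1"
    and I: "lie_ideal class_ring (UT0 ns) I" and nd: "\<not> I \<subseteq> layer ns 2"
  obtains p q where "p < sum_list ns" "q < sum_list ns" "p \<noteq> q"
    "block_index ns q \<le> Suc (block_index ns p)" "elementary (sum_list ns) p q \<in> I"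
proof -
  let ?n = "sum_list ns" and ?b = "block_index ns"
  note ideal = lie_ideal_UT0[OF I]
  obtain x where x: "x \<in> I" "x \<notin> layer ns 2" using nd by blast
  then have xL: "x \<in> carrier (UT0 ns)" using ideal(1) by blast
  then obtain i j where ij: "i < ?n" "j < ?n" "?b j < ?b i + 2" "x $$ (i, j) \<noteq> 0"
    using x(2) by (auto simp: layer_def)
  show ?thesis
  proof (cases "i = j")
    case False
    then have "elementary ?n i j \<in> I" using ideal_contains_elementary[OF I x(1)] ij by blast
    then show ?thesis using that[of i j] ij False by simp
  next
    case True
    have "\<exists>r. Suc r < ?n \<and> x $$ (r, r) \<noteq> x $$ (Suc r, Suc r)"
    proof (rule ccontr)
      assume "\<not> ?thesis"
      then have eq: "x $$ (r, r) = x $$ (0, 0)" if "r < ?n" for r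
        using that by (induction r) auto
      have "(\<Sum>r<?n. x $$ (r, r)) = (\<Sum>r<?n. x $$ (0, 0))" by (intro sum.cong refl) (rule eq, simp)
      also have "\<dots> = of_nat ?n * x $$ (0, 0)" by simp
      finally have "of_nat ?n * x $$ (0, 0) = 0" using xL by (simp add: UT0_iff)
      moreover have "of_nat ?n \<noteq> (0 :: 'a)" using ij(1) unfolding of_nat_eq_0_iff by linarith
      ultimately show False using ij True eq[of i] by (simp del: sum_list_eq_0_iff)
    qed
    then obtain r where r: "Suc r < ?n" "x $$ (r, r) \<noteq> x $$ (Suc r, Suc r)" by blast
    have "?b r \<le> ?b (Suc r)" using r by (intro block_index_mono) auto
    then have "elementary ?n r (Suc r) \<in> I"
      using r by (intro ideal_elementary_bracket[OF I x(1), of r "Suc r"]) auto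
    then show ?thesis using that[of r "Suc r"] r block_index_Suc[OF pos r(1)] by simp
  qed
qed

text \<open>The ideal contains every \<open>E\<^sub>r\<^sub>t\<close> with \<open>r \<noteq> t\<close>, the block of \<open>r\<close> at or before that of \<open>p\<close> and the block
  of \<open>t\<close> at or after that of \<open>q\<close>. Commuting with these forces the diagonal of \<open>c\<close> to be constant, hence
  zero, and forces every entry of \<open>c\<close> outside layer \<open>2\<close> to sit at one of these positions \<open>(r, t)\<close>. So \<open>c\<close>
  splits into a combination of elementary matrices from \<open>I\<close> and an element of layer \<open>2\<close>.\<close>

lemma annihilator_of_ideal:
  fixes I :: "'a :: field_char_0 mat set"
  assumes pos: "\<forall>m \<in> set ns. m \<ge> 1"
    and I: "lie_ideal class_ring (UT0 ns) I" and nd: "\<not> I \<subseteq> layer ns 2"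
    and c: "c \<in> carrier (UT0 ns)"
    and comm: "\<And>x. x \<in> I \<Longrightarrow> c * x - x * c = 0\<^sub>m (sum_list ns) (sum_list ns)"
  shows "\<exists>s \<in> I. \<exists>z \<in> layer ns 2. c = s + z"
proof -
  let ?n = "sum_list ns" and ?b = "block_index ns"
  note ideal = lie_ideal_UT0[OF I]
  have cc: "c \<in> carrier_mat ?n ?n" using c by (rule UT0_carrier_mat)
  obtain p q where pq: "p < ?n" "q < ?n" "p \<noteq> q" "?b q \<le> Suc (?b p)" and E: "elementary ?n p q \<in> I"
    using not_layer_contains_elementary[OF pos I nd] by blast
  have up: "elementary ?n r t \<in> I"
    if "r < ?n" "t < ?n" "r \<noteq> t" "?b r \<le> ?b p" "?b q \<le> ?b t" for r t
    using ideal_elementary_upward[OF I E pq(1-3) that] .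
  have entry: "(if j = t then c $$ (i, r) else 0) = (if i = r then c $$ (t, j) else 0)"
    if "r < ?n" "t < ?n" "r \<noteq> t" "?b r \<le> ?b p" "?b q \<le> ?b t" "i < ?n" "j < ?n" for r t i j
  proof -
    have "(c * elementary ?n r t - elementary ?n r t * c) $$ (i, j) = 0"
      using comm[OF up] that by simp
    then show ?thesis using bracket_elementary_index[OF cc that(1,2,6,7)] by simp
  qed
  \<comment> \<open>As \<open>q\<close> is at most one block after \<open>p\<close>, each index is admissible as a row or as a column.\<close>
  have diag: "c $$ (u, u) = c $$ (p, p)" if u: "u < ?n" for u
  proof -
    have eq: "c $$ (r, r) = c $$ (t, t)"
      if "r < ?n" "t < ?n" "r \<noteq> t" "?b r \<le> ?b p" "?b q \<le> ?b t" for r t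
      using entry[OF that that(1,2)] by simp
    show ?thesis
    proof (cases "?b u \<le> ?b p")
      case True
      then show ?thesis using eq[of u q] eq[of p q] pq u by (cases "u = q") auto
    next
      case False
      then show ?thesis using eq[of p u] pq u by (cases "u = p") auto
    qed
  qed
  have diag0: "c $$ (u, u) = 0" if u: "u < ?n" for u
  proof -
    have "(\<Sum>i<?n. c $$ (i, i)) = (\<Sum>i<?n. c $$ (p, p))" by (intro sum.cong refl) (rule diag, simp)
    then have "of_nat ?n * c $$ (p, p) = 0" using c by (simp add: UT0_iff)
    moreover have "of_nat ?n \<noteq> (0 :: 'a)" using u unfolding of_nat_eq_0_iff by linarith
    ultimately show ?thesis using diag[OF u] by (simp del: sum_list_eq_0_iff)
  qed
  have near: "elementary ?n u v \<in> I"
    if uv: "u < ?n" "v < ?n" "?b v < ?b u + 2" "c $$ (u, v) \<noteq> 0" for u v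
  proof -
    have ne: "u \<noteq> v" using uv diag0 by auto
    have "?b u \<le> ?b p"
    proof (rule ccontr)
      assume *: "\<not> ?b u \<le> ?b p"
      have "?b u \<le> ?b v" using c uv by (auto simp: UT0_iff not_less[symmetric])
      then have "p \<noteq> u" "p \<noteq> v" using * by auto
      then show False using entry[of p u p v] pq uv ne * by auto
    qed
    moreover have "?b q \<le> ?b v"
    proof (rule ccontr)
      assume *: "\<not> ?b q \<le> ?b v"
      then show False using entry[of v q u q] pq uv ne by auto
    qed
    ultimately show ?thesis using up uv ne by blast
  qed
  define s where "s = mat ?n ?n (\<lambda>(i, j). if ?b j < ?b i + 2 then c $$ (i, j) else 0)"
  define z where "z = mat ?n ?n (\<lambda>(i, j). if ?b j < ?b i + 2 then 0 else c $$ (i, j))"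
  have "s \<in> I"
  proof (rule elementary_span)
    show "0\<^sub>m ?n ?n \<in> I" by (rule ideal(2))
    show "s \<in> carrier_mat ?n ?n" by (simp add: s_def)
    show "elementary ?n i j \<in> I" if "i < ?n" "j < ?n" "s $$ (i, j) \<noteq> 0" for i j
      using that near by (auto simp: s_def split: if_splits)
  qed (intro ideal(3,4))
  moreover have "z \<in> layer ns 2" by (auto simp: layer_def UT0_iff z_def)
  moreover have "c = s + z" using cc by (intro eq_matI) (auto simp: s_def z_def)
  ultimately show ?thesis by blast
qed

theorem theorem24:
  fixes ns :: "nat list"
    and G :: "('g, 'm) monoid_scheme"
    and \<Gamma> :: "'g \<Rightarrow> 'a :: field_char_0 mat set"
  assumes "ns \<noteq> []"
    and "\<forall>m \<in> set ns. m \<ge> 1"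
    and "lie_grading G class_ring (UT0 ns) \<Gamma>"
  shows "comm_group (G\<lparr>carrier := generate G (grading_support G (UT0 ns) \<Gamma>)\<rparr>)"
proof -
  interpret lie_grading G class_ring "UT0 ns" \<Gamma> by fact
  show ?thesis
  proof (rule grp.generate_comm_group)
    show "grading_support G (UT0 ns) \<Gamma> \<subseteq> carrier G" by (auto simp: grading_support_def)
  next
    fix a b
    assume "a \<in> grading_support G (UT0 ns) \<Gamma>" "b \<in> grading_support G (UT0 ns) \<Gamma>"
    then show "a \<otimes>\<^bsub>G\<^esub> b = b \<otimes>\<^bsub>G\<^esub> a"
    proof (rule support_commutes[where N = "layer ns 2", rotated -2])
      show "layer ns 2 \<subseteq> carrier (UT0 ns)" by (auto simp: layer_def)
      show "\<zero>\<^bsub>UT0 ns\<^esub> \<in> layer ns 2" by (simp add: UT0_simps layer_zero)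
      show "x \<oplus>\<^bsub>UT0 ns\<^esub> y \<in> layer ns 2" if "x \<in> layer ns 2" "y \<in> layer ns 2" for x y :: "'a mat"
        using that by (simp add: UT0_simps layer_add)
    next
      fix S :: "'a mat set"
      assume "lie_subalgebra class_ring (UT0 ns) S"
        and "\<And>x. x \<in> carrier (UT0 ns) \<Longrightarrow> \<exists>s \<in> S. \<exists>z \<in> layer ns 2. x = s \<oplus>\<^bsub>UT0 ns\<^esub> z"
      then show "S = carrier (UT0 ns)"
        by (intro subalgebra_eq_UT0[OF assms(2)]) (simp_all add: UT0_simps)
    next
      fix I :: "'a mat set" and c :: "'a mat"
      assume I: "lie_ideal class_ring (UT0 ns) I" and nd: "\<not> I \<subseteq> layer ns 2" and c: "c \<in> carrier (UT0 ns)"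
        and comm: "\<And>x. x \<in> I \<Longrightarrow> c \<otimes>\<^bsub>UT0 ns\<^esub> x = \<zero>\<^bsub>UT0 ns\<^esub>"
      have "\<exists>s \<in> I. \<exists>z \<in> layer ns 2. c = s + z"
        using comm by (intro annihilator_of_ideal[OF assms(2) I nd c]) (simp add: UT0_simps)
      then show "\<exists>s \<in> I. \<exists>z \<in> layer ns 2. c = s \<oplus>\<^bsub>UT0 ns\<^esub> z" by (simp add: UT0_simps)
    qed
  qed
qed

end
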